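(* Let $k\ge 1$ be an integer. For $n\ge 1$ write the $n$th cyclotomic polynomial as $\Phi_n(X)=\prod_{1\le j\le n,\,(j,n)=1}(X-e^{2\pi i j/n})=\sum_{m=0}^{\varphi(n)}a_n(m)X^m$, and put $a_n(m)=0$ for $m>\varphi(n)$. Then the mean value $M_n(a_n(k))=\lim_{x\to\infty}\frac1x\sum_{n\le x}a_n(k)$ exists and $$M_n(a_n(k))=\frac{3}{\pi^2}\sum_{\lambda}\frac{\epsilon(\lambda)}{G(\lambda)\prod_{p\mid L(\lambda)/G(\lambda)}(p+1)},$$ where the sum runs over all partitions $\lambda$ of $k$ (each partition counted once), a partition being written as $\lambda=(k_1^{n_{k_1}}\cdots k_s^{n_{k_s}})$ with distinct parts $k_1,\dots,k_s$, the part $k_j$ occurring $n_{k_j}\ge 1$ times (so $\sum_j n_{k_j}k_j=k$); here $L(\lambda)=\mathrm{lcm}(k_1,\dots,k_s)$, $G(\lambda)=\gcd(k_1,\dots,k_s)$, the product is over primes $p$, and $$\epsilon(\lambda)=\prod_{j=1}^s(-1)^{n_{k_j}}\binom{\mu(L(\lambda)/k_j)}{n_{k_j}}+\prod_{j=1}^s(-1)^{n_{k_j}}\binom{-\mu(L(\lambda)/k_j)}{n_{k_j}}.$$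
   Context: $\mu$ is the Möbius function and $\varphi$ Euler's totient. For an integer (possibly negative) $a$ and integer $j\ge 0$, $\binom{a}{j}=a(a-1)\cdots(a-j+1)/j!$ (generalized binomial coefficient, equal to $1$ for $j=0$). *)

theory Defs
  imports
    "HOL-Analysis.Analysis"
    "HOL-Computational_Algebra.Computational_Algebra"
    "HOL-Library.Multiset"
begin

definition moebius_mu :: "nat \<Rightarrow> int" where
  "moebius_mu n = (if squarefree n then (-1) ^ card (prime_factors n) else 0)"

definition cyclotomic :: "nat \<Rightarrow> complex poly" where
  "cyclotomic n =
     (\<Prod>j | 1 \<le> j \<and> j \<le> n \<and> coprime j n.
        [:- exp (2 * of_real pi * \<i> * of_nat j / of_nat n), 1:])"

text \<open>The function \<open>coeff\<close> vanishes beyond the degree, so no separate convention is needed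
  for the coefficients with \<open>m > \<phi>(n)\<close>.\<close>

definition cyc_coeff :: "nat \<Rightarrow> nat \<Rightarrow> complex" where
  "cyc_coeff n m = coeff (cyclotomic n) m"

definition has_mean_value :: "(nat \<Rightarrow> complex) \<Rightarrow> complex \<Rightarrow> bool" where
  "has_mean_value f M \<longleftrightarrow>
     ((\<lambda>x::real. 1 / of_real x * (\<Sum>n | 1 \<le> n \<and> real n \<le> x. f n)) \<longlongrightarrow> M) at_top"

text \<open>A partition is the multiset of its parts: the distinct parts are the elements of
  \<open>set_mset P\<close>, and the part \<open>d\<close> occurs \<open>count P d\<close> times.\<close>

definition partitions :: "nat \<Rightarrow> nat multiset set" where
  "partitions k = {P. 0 \<notin># P \<and> sum_mset P = k}"

definition part_lcm :: "nat multiset \<Rightarrow> nat" where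
  "part_lcm P = Lcm (set_mset P)"

definition part_gcd :: "nat multiset \<Rightarrow> nat" where
  "part_gcd P = Gcd (set_mset P)"

definition part_eps :: "nat multiset \<Rightarrow> real" where
  "part_eps P =
     (\<Prod>d\<in>set_mset P. (-1) ^ count P d *
        (of_int (moebius_mu (part_lcm P div d)) gchoose count P d)) +
     (\<Prod>d\<in>set_mset P. (-1) ^ count P d *
        (of_int (- moebius_mu (part_lcm P div d)) gchoose count P d))"

end

theory Submission
  imports Defs "HOL-Complex_Analysis.Complex_Analysis"
begin

text \<open>
  For \<open>n > 1\<close> the identity \<open>\<Phi>\<^sub>n(X) = \<Prod>\<^bsub>d | n\<^esub> (1 - X\<^sup>d)\<^bsup>\<mu>(n/d)\<^esup>\<close>
  writes the \<open>k\<close>-th coefficient as a sum over the partitions of \<open>k\<close>. A partition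
  with least common multiple \<open>L\<close> and greatest common divisor \<open>G\<close> contributes only when \<open>n = L m\<close>
  with \<open>m\<close> coprime to \<open>L/G\<close>, and then \<open>\<mu>(n/d) = \<mu>(m) \<mu>(L/d)\<close>, so its contribution depends on \<open>m\<close>
  only through \<open>\<mu>(m) \<in> {-1, 0, 1}\<close>. It remains to know the means of \<open>\<mu>\<^sup>2\<close> and \<open>\<mu>\<close> over the \<open>m\<close> coprime to
  \<open>L/G\<close>. The first is elementary; the second is \<open>0\<close>, which is equivalent to the prime number
  theorem and already needed for \<open>k = 1\<close>, where the coefficient is \<open>-\<mu>(n)\<close>. It follows from the
  convergence of \<open>\<Sum> \<mu>(n)/n\<close> to \<open>0\<close>, proved by Newman's contour argument from the analytic
  continuation of \<open>\<zeta>\<close> and its non-vanishing on the line \<open>Re s = 1\<close>.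
\<close>

unbundle no vec_syntax
unbundle fps_syntax
no_notation Infinite_Set_Sum.abs_summable_on (infix "abs'_summable'_on" 50)

section \<open>The Moebius function\<close>

text \<open>Write A(s) for the contribution of a partition when mu(m) = s. Since A(0) = 0, it is an
  even part times s^2 plus an odd part times s. Only mu^2 has a nonzero mean, so the even part
  survives: it is half of epsilon = A(1) + A(-1), and half of 6/pi^2 is the constant 3/pi^2.
  Restricting m to be coprime to L/G divides this mean by the product of the 1 + 1/p, and passing
  from m to n = L m divides it by L. If L/G is squarefree, the two divisors multiply to G times the
  product of the p + 1; otherwise epsilon is 0. Both sieved means come from one recursion: removing
  a prime q relates the old summatory function S to the new one S' by S(N) = S'(N) + a S'(N div q),
  with a = 1 for mu^2 and a = -1 for mu. As |a| = 1, the decay has to come from N div q being at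
  most N/2. In the contour argument the zero of 1/zeta(1 + z) at z = 0 cancels the pole of the
  kernel, so the half-disc can be closed along the boundary line itself.\<close>

lemma moebius_mu_1 [simp]: "moebius_mu (Suc 0) = 1"
  by (simp add: moebius_mu_def)

lemma abs_moebius_mu_le: "\<bar>moebius_mu n\<bar> \<le> 1"
  by (simp add: moebius_mu_def)

lemma moebius_mu_cases: "moebius_mu n = 0 \<or> moebius_mu n = 1 \<or> moebius_mu n = -1"
  using abs_moebius_mu_le[of n] by linarith

lemma moebius_mu_eq_0_iff: "moebius_mu n = 0 \<longleftrightarrow> \<not> squarefree n"
  by (simp add: moebius_mu_def)

lemma moebius_mu_mult_coprime:
  assumes "coprime a b"
  shows "moebius_mu (a * b) = moebius_mu a * moebius_mu b"
proof (cases "squarefree a \<and> squarefree b")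
  case True
  have nz: "a \<noteq> 0" "b \<noteq> 0"
    using True by (metis not_squarefree_0)+
  have "prime_factors a \<inter> prime_factors b = {}"
    using assms by (auto simp: in_prime_factors_iff dest: coprime_common_divisor_nat not_prime_unit)
  moreover have "squarefree (a * b)"
    using True assms by (simp add: squarefree_mult_coprime)
  ultimately show ?thesis
    using True nz
    by (simp add: moebius_mu_def prime_factors_product card_Un_disjoint power_add)
next
  case False
  then have "\<not> squarefree (a * b)"
    using squarefree_multD by blast
  then show ?thesis
    using False by (auto simp: moebius_mu_def)
qed

lemma moebius_mu_prime:
  assumes "prime p"
  shows "moebius_mu p = -1"
  using assms by (simp add: moebius_mu_def squarefree_prime prime_factorization_prime)

lemma moebius_mu_prime_mult:
  assumes "prime p"
  shows "moebius_mu (p * m) = (if p dvd m then 0 else - moebius_mu m)"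
proof (cases "p dvd m")
  case True
  then have "p\<^sup>2 dvd p * m"
    by (simp add: power2_eq_square)
  moreover have "\<not> p dvd 1"
    using assms not_prime_unit by blast
  ultimately show ?thesis
    using True by (simp add: moebius_mu_eq_0_iff not_squarefreeI)
next
  case False
  then have "coprime p m"
    using assms prime_imp_coprime by blast
  then show ?thesis
    using assms False by (simp add: moebius_mu_mult_coprime moebius_mu_prime)
qed

text \<open>For a prime \<open>p\<close> dividing \<open>n\<close>, the divisors \<open>d\<close>
  not divisible by \<open>p\<close> pair off with \<open>p * d\<close>, whose Moebius value is
  opposite. Every divisor left over is divisible by the square of \<open>p\<close> and contributes
  0.\<close>

lemma sum_moebius_mu_divisors:
  assumes "n > 0"
  shows "(\<Sum>d | d dvd n. moebius_mu d) = (if n = 1 then 1 else 0)"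
proof (cases "n = 1")
  case False
  then obtain p where p: "prime p" "p dvd n"
    using prime_factor_nat by blast
  let ?A = "{d. d dvd n \<and> \<not> p dvd d}"
  have fin: "finite {d. d dvd n}"
    using assms by simp
  have p0: "p > 0"
    using p(1) prime_gt_0_nat by blast
  have "inj_on ((*) p) ?A"
    using p0 by (auto simp: inj_on_def)
  then have "(\<Sum>d\<in>(*) p ` ?A. moebius_mu d) = (\<Sum>d\<in>?A. moebius_mu (p * d))"
    by (simp add: sum.reindex)
  also have "\<dots> = (\<Sum>d\<in>?A. - moebius_mu d)"
    by (intro sum.cong) (auto simp: moebius_mu_prime_mult p)
  finally have 1: "(\<Sum>d\<in>(*) p ` ?A. moebius_mu d) = - (\<Sum>d\<in>?A. moebius_mu d)"
    by (simp add: sum_negf)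
  have sub: "(*) p ` ?A \<subseteq> {d. d dvd n \<and> p dvd d}"
  proof clarsimp
    fix d assume "d dvd n" "\<not> p dvd d"
    then show "p * d dvd n"
      using p by (intro divides_mult) (auto intro: prime_imp_coprime)
  qed
  have "(\<Sum>d | d dvd n. moebius_mu d)
      = (\<Sum>d\<in>?A. moebius_mu d) + (\<Sum>d | d dvd n \<and> p dvd d. moebius_mu d)"
    by (subst sum.union_disjoint [symmetric]) (use fin in \<open>auto intro!: sum.cong\<close>)
  also have "(\<Sum>d | d dvd n \<and> p dvd d. moebius_mu d) = (\<Sum>d\<in>(*) p ` ?A. moebius_mu d)"
  proof (rule sum.mono_neutral_right [OF _ sub], use fin in simp, safe)
    fix d assume d: "d dvd n" "p dvd d" "d \<notin> (*) p ` ?A"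
    then obtain e where e: "d = p * e"
      by blast
    have "e dvd n"
      using d e dvd_mult_right by blast
    then have "p dvd e"
      using d(3) e by auto
    then show "moebius_mu d = 0"
      by (simp add: e moebius_mu_prime_mult p)
  qed
  finally show ?thesis
    using False 1 by simp
qed auto

section \<open>The zeta function in the half-plane of absolute convergence\<close>

text \<open>The mean value theorem stands in for comparing a sum of powers with an integral: the
  increments on the left telescope, and monotonicity turns \<open>\<xi>\<close> into an
  endpoint.\<close>

lemma powr_increment_mvt:
  fixes a y :: real
  assumes "a > 0"
  obtains \<xi> where "a < \<xi>" "\<xi> < a + 1" "(a + 1) powr y - a powr y = y * \<xi> powr (y - 1)"
proof -
  have "\<exists>\<xi>>a. \<xi> < a + 1 \<and> (a + 1) powr y - a powr y = (a + 1 - a) * (y * \<xi> powr (y - 1))"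
    using assms by (intro MVT2) (auto intro!: derivative_eq_intros simp: field_simps)
  then show ?thesis
    using that by auto
qed

text \<open>Each term is at most a telescoping increment of \<open>n powr (- x) / x\<close>.
  Arbitrary finite \<open>F\<close> are allowed because summability and bounds for
  \<open>infsum\<close> are tested on finite subsets.\<close>

lemma sum_powr_tail_le:
  fixes x :: real
  assumes "x > 0" "N \<ge> 1" "finite F" "F \<subseteq> {N<..}"
  shows "(\<Sum>n\<in>F. real n powr (- 1 - x)) \<le> real N powr (- x) / x"
proof -
  have step: "real (Suc m) powr (- 1 - x) \<le> (real m powr (- x) - real (Suc m) powr (- x)) / x"
    if m: "m \<ge> 1" for m
  proof -
    obtain \<xi> where \<xi>: "real m < \<xi>" "\<xi> < real m + 1"
      "(real m + 1) powr (- x) - real m powr (- x) = - x * \<xi> powr (- x - 1)"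
      by (rule powr_increment_mvt[of "real m" "- x"]) (use m in auto)
    have "(real m + 1) powr (- x - 1) \<le> \<xi> powr (- x - 1)"
      using \<xi> assms m by (intro powr_mono2') auto
    then have "x * (real m + 1) powr (- x - 1) \<le> x * \<xi> powr (- x - 1)"
      using assms(1) by (intro mult_left_mono) auto
    then have "(real m + 1) powr (- x - 1) * x \<le> real m powr (- x) - (real m + 1) powr (- x)"
      using \<xi>(3) by (simp add: mult.commute)
    moreover have "- 1 - x = - x - 1"
      by simp
    ultimately show ?thesis
      using assms(1) by (simp only: pos_le_divide_eq of_nat_Suc add.commute)
  qed
  have partial: "(\<Sum>n\<in>{N<..M}. real n powr (- 1 - x)) \<le> (real N powr (- x) - real M powr (- x)) / x"
    if "M \<ge> N" for M
    using that
  proof (induction M rule: dec_induct)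
    case (step M)
    have "{N<..Suc M} = insert (Suc M) {N<..M}"
      using step.hyps by auto
    then have "(\<Sum>n\<in>{N<..Suc M}. real n powr (- 1 - x))
        \<le> (real M powr (- x) - real (Suc M) powr (- x)) / x + (real N powr (- x) - real M powr (- x)) / x"
      using step.IH \<open>\<And>m. m \<ge> 1 \<Longrightarrow> real (Suc m) powr (- 1 - x) \<le> _\<close>[of M] step.hyps assms(2)
      by simp
    also have "\<dots> = (real N powr (- x) - real (Suc M) powr (- x)) / x"
      by (simp add: diff_divide_distrib)
    finally show ?case .
  qed auto
  define M where "M = max N (Max (insert 0 F))"
  have "F \<subseteq> {N<..M}"
    using assms(3,4) unfolding M_def by (auto simp: le_max_iff_disj)
  then have "(\<Sum>n\<in>F. real n powr (- 1 - x)) \<le> (\<Sum>n\<in>{N<..M}. real n powr (- 1 - x))"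
    by (intro sum_mono2) auto
  also have "\<dots> \<le> (real N powr (- x) - real M powr (- x)) / x"
    by (intro partial) (auto simp: M_def)
  also have "\<dots> \<le> real N powr (- x) / x"
    using assms(1) by (intro divide_right_mono) auto
  finally show ?thesis .
qed

lemma summable_on_powr_tail:
  assumes "x > 0" "N \<ge> 1"
  shows "(\<lambda>n. real n powr (- 1 - x)) summable_on {N<..}"
proof (rule nonneg_bdd_above_summable_on)
  show "bdd_above (sum (\<lambda>n. real n powr (- 1 - x)) ` {F. F \<subseteq> {N<..} \<and> finite F})"
    by (rule bdd_aboveI[of _ "real N powr (- x) / x"]) (use assms sum_powr_tail_le in auto)
qed auto

lemma infsum_powr_tail_le:
  assumes "x > 0" "N \<ge> 1"
  shows "(\<Sum>\<^sub>\<infinity>n\<in>{N<..}. real n powr (- 1 - x)) \<le> real N powr (- x) / x"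
  using assms by (intro infsum_le_finite_sums summable_on_powr_tail sum_powr_tail_le)

lemma summable_on_powr:
  assumes "x > 0"
  shows "(\<lambda>n. real n powr (- 1 - x)) summable_on A"
proof -
  have "(\<lambda>n. real n powr (- 1 - x)) summable_on {..1} \<union> {1<..}"
    using assms by (intro summable_on_Un_disjoint summable_on_powr_tail) auto
  also have "{..1} \<union> {1<..} = (UNIV :: nat set)"
    by auto
  finally show ?thesis
    by (rule summable_on_subset_banach) auto
qed

lemma norm_of_nat_powr: "norm (of_nat n powr z :: complex) = real n powr Re z"
  by (subst norm_powr_real_powr) auto

lemma abs_summable_on_bounded_dirichlet:
  fixes c :: "nat \<Rightarrow> complex"
  assumes "Re s > 1" "\<And>n. norm (c n) \<le> 1"
  shows "(\<lambda>n. c n * of_nat n powr (- s)) abs_summable_on A"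
proof (rule Infinite_Sum.abs_summable_on_comparison_test')
  show "(\<lambda>n. real n powr (- 1 - (Re s - 1))) summable_on A"
    using assms(1) by (intro summable_on_powr) auto
  show "norm (c n * of_nat n powr (- s)) \<le> real n powr (- 1 - (Re s - 1))" for n
    using mult_right_mono[OF assms(2)[of n], of "real n powr (- Re s)"]
    by (simp add: norm_mult norm_of_nat_powr)
qed

lemmas summable_on_bounded_dirichlet =
  abs_summable_on_bounded_dirichlet [THEN Infinite_Sum.abs_summable_summable]

lemma abs_summable_on_dirichlet:
  "Re s > 1 \<Longrightarrow> (\<lambda>n. of_nat n powr (- s) :: complex) abs_summable_on A"
  using abs_summable_on_bounded_dirichlet[of s "\<lambda>_. 1"] by simp

lemmas summable_on_dirichlet = abs_summable_on_dirichlet [THEN Infinite_Sum.abs_summable_summable]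

text \<open>Two tails need this bound: that of the Moebius series, and the integers surviving a
  sieve, hence the arbitrary \<open>A\<close>. The explicit denominator \<open>Re s - 1\<close>
  matters, since on Newman's contour it is cancelled by the kernel.\<close>

lemma norm_infsum_dirichlet_tail_le:
  fixes c :: "nat \<Rightarrow> complex"
  assumes "Re s > 1" "\<And>n. norm (c n) \<le> 1" "N \<ge> 1" "A \<subseteq> {N<..}"
  shows "norm (\<Sum>\<^sub>\<infinity>n\<in>A. c n * of_nat n powr (- s)) \<le> real N powr (1 - Re s) / (Re s - 1)"
proof -
  define x where "x = Re s - 1"
  have x: "x > 0" using assms by (simp add: x_def)
  have "norm (\<Sum>\<^sub>\<infinity>n\<in>A. c n * of_nat n powr (- s)) \<le> (\<Sum>\<^sub>\<infinity>n\<in>A. norm (c n * of_nat n powr (- s)))"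
    using assms by (intro norm_infsum_bound abs_summable_on_bounded_dirichlet)
  also have "\<dots> \<le> (\<Sum>\<^sub>\<infinity>n\<in>A. real n powr (- 1 - x))"
  proof (rule infsum_mono)
    show "(\<lambda>n. norm (c n * of_nat n powr (- s))) summable_on A"
      using assms by (intro abs_summable_on_bounded_dirichlet)
    show "(\<lambda>n. real n powr (- 1 - x)) summable_on A"
      using x by (rule summable_on_powr)
    show "norm (c n * of_nat n powr (- s)) \<le> real n powr (- 1 - x)" for n
      using mult_right_mono[OF assms(2)[of n], of "real n powr (- Re s)"]
      by (simp add: norm_mult norm_of_nat_powr x_def)
  qed
  also have "\<dots> \<le> (\<Sum>\<^sub>\<infinity>n\<in>{N<..}. real n powr (- 1 - x))"
    using x assms by (intro infsum_mono2 summable_on_powr) auto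
  also have "\<dots> \<le> real N powr (- x) / x"
    using x assms by (intro infsum_powr_tail_le)
  finally show ?thesis
    by (simp add: x_def)
qed

text \<open>The index \<open>0\<close> contributes \<open>0 powr (- s) = 0\<close>.\<close>

definition zeta :: "complex \<Rightarrow> complex" where
  "zeta s = (\<Sum>\<^sub>\<infinity>n. of_nat n powr (- s))"

text \<open>Absolute convergence allows the double series over \<open>(d, m)\<close> to be regrouped
  by \<open>n = d * m\<close>, where the inner divisor sum leaves only \<open>n = 1\<close>. Index 0
  is dropped beforehand: its terms are 0, and on positive integers the regrouping is a bijection
  with finite fibres.\<close>

lemma moebius_dirichlet_mult_zeta:
  assumes "Re s > 1"
  shows "(\<Sum>\<^sub>\<infinity>n. of_int (moebius_mu n) * of_nat n powr (- s)) * zeta s = 1"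
proof -
  define f where "f = (\<lambda>n. of_int (moebius_mu n) * of_nat n powr (- s) :: complex)"
  define g where "g = (\<lambda>n. of_nat n powr (- s) :: complex)"
  have norm_mu: "norm (of_int (moebius_mu n) :: complex) \<le> 1" for n
    using moebius_mu_cases[of n] by auto
  have f: "f abs_summable_on A" for A
    unfolding f_def using assms norm_mu by (intro abs_summable_on_bounded_dirichlet)
  have g: "g abs_summable_on A" for A
    unfolding g_def using assms by (intro abs_summable_on_dirichlet)
  let ?N = "{0<..} :: nat set"
  have fg: "(\<lambda>(d, m). f d * g m) abs_summable_on ?N \<times> ?N"
    unfolding Infinite_Sum.abs_summable_on_Sigma_iff
    by (auto simp: norm_mult abs_mult infsum_cmult_right' intro!: summable_on_cmult_left f summable_on_cmult_right g)
  then have fg': "(\<lambda>(d, m). f d * g m) summable_on ?N \<times> ?N"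
    by (rule Infinite_Sum.abs_summable_summable)
  let ?S = "SIGMA n:?N. {d. d dvd n}"
  have wit: "(\<lambda>(n, d). of_int (moebius_mu d) * of_nat n powr (- s)) summable_on ?S
      \<longleftrightarrow> (\<lambda>(d, m). f d * g m) summable_on ?N \<times> ?N"
    by (rule summable_on_reindex_bij_witness
        [where i = "\<lambda>(d, m). (d * m, d)" and j = "\<lambda>(n, d). (d, n div d)"])
      (auto simp: f_def g_def elim!: dvdE intro: Nat.gr0I simp: powr_times_real)
  have "infsum f UNIV * infsum g UNIV = infsum f ?N * infsum g ?N"
    by (intro arg_cong2[where f = "(*)"] infsum_cong_neutral) (auto simp: f_def g_def)
  also have "\<dots> = (\<Sum>\<^sub>\<infinity>d\<in>?N. \<Sum>\<^sub>\<infinity>m\<in>?N. f d * g m)"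
    by (simp add: infsum_cmult_left' infsum_cmult_right')
  also have "\<dots> = infsum (\<lambda>(d, m). f d * g m) (?N \<times> ?N)"
    using fg' by (rule infsum_Sigma'_banach)
  also have "\<dots> = infsum (\<lambda>(n, d). of_int (moebius_mu d) * of_nat n powr (- s)) ?S"
    by (rule sym, rule infsum_reindex_bij_witness
        [where i = "\<lambda>(d, m). (d * m, d)" and j = "\<lambda>(n, d). (d, n div d)"])
      (auto simp: f_def g_def elim!: dvdE intro: Nat.gr0I simp: powr_times_real)
  also have "\<dots> = (\<Sum>\<^sub>\<infinity>n\<in>?N. \<Sum>\<^sub>\<infinity>d\<in>{d. d dvd n}. of_int (moebius_mu d) * of_nat n powr (- s))"
    using wit fg' by (intro infsum_Sigma'_banach [symmetric]) simp
  also have "\<dots> = (\<Sum>\<^sub>\<infinity>n\<in>{1::nat}. 1)"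
  proof (rule infsum_cong_neutral)
    have eq: "(\<Sum>\<^sub>\<infinity>d\<in>{d. d dvd n}. of_int (moebius_mu d) * of_nat n powr (- s))
        = of_int (if n = 1 then 1 else 0) * (of_nat n powr (- s) :: complex)" if "n > 0" for n
      using that by (simp only: infsum_finite finite_divisors_nat sum_distrib_right [symmetric]
          of_int_sum [symmetric] sum_moebius_mu_divisors)
    show "(\<Sum>\<^sub>\<infinity>d\<in>{d. d dvd n}. of_int (moebius_mu d) * of_nat n powr (- s)) = (0::complex)"
      if "n \<in> ?N - {1}" for n
      using that by (subst eq) auto
    show "(\<Sum>\<^sub>\<infinity>d\<in>{d. d dvd n}. of_int (moebius_mu d) * of_nat n powr (- s)) = (1::complex)"
      if "n \<in> ?N \<inter> {1}" for n
      using that by (subst eq) auto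
  qed auto
  finally show ?thesis
    by (simp add: f_def g_def zeta_def)
qed

lemma zeta_nonzero: "Re s > 1 \<Longrightarrow> zeta s \<noteq> 0"
  using moebius_dirichlet_mult_zeta by fastforce

section \<open>The Euler product as a sieve\<close>

text \<open>Multiplication by a new prime \<open>q\<close> maps the sieved set onto its multiples of
  \<open>q\<close>, because no earlier prime divides \<open>q\<close>. Those multiples carry the
  fraction \<open>q powr (- s)\<close> of the sum, so removing them multiplies it by
  \<open>1 - q powr (- s)\<close>.\<close>

lemma infsum_dirichlet_sieved:
  assumes "Re s > 1" "finite P" "\<And>p. p \<in> P \<Longrightarrow> prime p"
  shows "(\<Sum>\<^sub>\<infinity>n\<in>{n. \<forall>p\<in>P. \<not> p dvd n}. of_nat n powr (- s))
    = zeta s * (\<Prod>p\<in>P. 1 - of_nat p powr (- s))"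
  using assms(2,3)
proof (induction P rule: finite_induct)
  case empty
  then show ?case by (simp add: zeta_def)
next
  case (insert q P)
  let ?S = "{n. \<forall>p\<in>P. \<not> p dvd n}"
  let ?f = "\<lambda>n. of_nat n powr (- s) :: complex"
  have q: "prime q" "q > 0"
    using insert.prems prime_gt_0_nat by auto
  have mem: "q * n \<in> ?S \<longleftrightarrow> n \<in> ?S" for n
  proof -
    have "\<not> p dvd q" if "p \<in> P" for p
      using that insert.prems insert.hyps q primes_dvd_imp_eq[of p q] by auto
    then show ?thesis
      using insert.prems by (auto simp: prime_dvd_mult_iff)
  qed
  have split: "?S = {n. \<forall>p\<in>insert q P. \<not> p dvd n} \<union> (*) q ` ?S"
  proof (intro equalityI subsetI)
    fix n assume n: "n \<in> ?S"
    show "n \<in> {n. \<forall>p\<in>insert q P. \<not> p dvd n} \<union> (*) q ` ?S"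
    proof (cases "q dvd n")
      case True
      then obtain k where "n = q * k" ..
      then show ?thesis using n mem[of k] by blast
    qed (use n in auto)
  next
    fix n assume "n \<in> {n. \<forall>p\<in>insert q P. \<not> p dvd n} \<union> (*) q ` ?S"
    then show "n \<in> ?S" using mem by blast
  qed
  have "infsum ?f ?S = infsum ?f {n. \<forall>p\<in>insert q P. \<not> p dvd n} + infsum ?f ((*) q ` ?S)"
    by (subst split, rule infsum_Un_disjoint) (auto intro!: summable_on_dirichlet assms)
  also have "infsum ?f ((*) q ` ?S) = infsum (\<lambda>n. ?f q * ?f n) ?S"
    using q by (subst infsum_reindex) (auto simp: inj_on_def o_def powr_times_real)
  also have "\<dots> = ?f q * infsum ?f ?S"
    by (rule infsum_cmult_right')
  finally have "infsum ?f {n. \<forall>p\<in>insert q P. \<not> p dvd n} = (1 - ?f q) * infsum ?f ?S"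
    by (simp add: algebra_simps)
  then show ?case
    using insert by simp
qed

text \<open>Once all primes up to \<open>N\<close> are sieved out, the only positive survivors are 1
  and integers above \<open>N\<close>, so the error is a tail of the series. Keeping the product on
  the side of \<open>zeta s\<close> avoids dividing by it.\<close>

lemma euler_product_zeta:
  assumes "Re s > 1"
  shows "(\<lambda>N. zeta s * (\<Prod>p | prime p \<and> p \<le> N. 1 - of_nat p powr (- s))) \<longlonglongrightarrow> 1"
proof (rule LIM_zero_cancel, rule Lim_null_comparison)
  have x: "Re s - 1 > 0" using assms by simp
  show "\<forall>\<^sub>F N in sequentially. norm (zeta s * (\<Prod>p | prime p \<and> p \<le> N. 1 - of_nat p powr (- s)) - 1)
      \<le> real N powr (1 - Re s) / (Re s - 1)"
    using eventually_ge_at_top[of 1]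
  proof eventually_elim
    case (elim N)
    let ?P = "{p. prime p \<and> p \<le> N}"
    let ?S = "{n. \<forall>p\<in>?P. \<not> p dvd n}"
    let ?f = "\<lambda>n. of_nat n powr (- s) :: complex"
    have "zeta s * (\<Prod>p\<in>?P. 1 - of_nat p powr (- s)) = infsum ?f ?S"
      using assms by (intro infsum_dirichlet_sieved [symmetric]) auto
    also have "\<dots> = infsum ?f ((?S - {0, 1}) \<union> {1})"
      by (rule infsum_cong_neutral) (auto dest: not_prime_unit)
    also have "\<dots> = infsum ?f (?S - {0, 1}) + infsum ?f {1}"
      by (rule infsum_Un_disjoint) (auto intro!: summable_on_dirichlet assms)
    finally have eq: "zeta s * (\<Prod>p\<in>?P. 1 - of_nat p powr (- s)) - 1 = infsum ?f (?S - {0, 1})"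
      by simp
    have "?S - {0, 1} \<subseteq> {N<..}"
    proof
      fix n assume n: "n \<in> ?S - {0, 1}"
      then obtain p where p: "prime p" "p dvd n"
        using prime_factor_nat[of n] by auto
      then have "p \<le> n" "\<not> p \<le> N"
        using n by (auto dest: dvd_imp_le)
      then show "n \<in> {N<..}" by simp
    qed
    then show ?case
      unfolding eq using norm_infsum_dirichlet_tail_le[OF assms, of "\<lambda>_. 1" N] elim by simp
  qed
  have "(\<lambda>N. real N powr (1 - Re s) / (Re s - 1)) \<longlonglongrightarrow> 0 / (Re s - 1)"
    using x by (intro tendsto_divide tendsto_neg_powr filterlim_real_sequentially tendsto_const) auto
  then show "(\<lambda>N. real N powr (1 - Re s) / (Re s - 1)) \<longlonglongrightarrow> 0"
    by simp
qed

section \<open>Analytic continuation and non-vanishing on the boundary line\<close>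

text \<open>The expression is the remainder of the first-order Taylor expansion of
  \<open>w powr (- z)\<close> at \<open>n\<close>, evaluated at \<open>n + 1\<close>. The second
  derivative gains two powers of \<open>n\<close>, which makes the series converge for
  \<open>Re z > -1\<close>; \<open>Re z \<ge> -2\<close> ensures that the bound on it is largest at
  the left endpoint.\<close>

lemma norm_zeta_summand_le:
  assumes "n \<ge> 1" "Re z \<ge> -2"
  shows "norm (z * of_nat n powr (- 1 - z) - of_nat n powr (- z) + of_nat (Suc n) powr (- z))
    \<le> norm (z * (z + 1)) * real n powr (- 2 - Re z)"
proof -
  define f where "f = (\<lambda>(i::nat) w. if i = 0 then w powr (- z) else if i = 1 then - z * w powr (- z - 1)
      else z * (z + 1) * w powr (- 2 - z) :: complex)"
  let ?S = "closed_segment (of_nat n) (of_nat (Suc n)) :: complex set"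
  have S: "\<exists>t. w = of_real t \<and> real n \<le> t" if "w \<in> ?S" for w
  proof -
    obtain u where u: "w = (1 - u) *\<^sub>R of_nat n + u *\<^sub>R of_nat (Suc n)" "0 \<le> u"
      using \<open>w \<in> ?S\<close> by (auto simp: closed_segment_def)
    then have "w = of_real (real n + u)"
      by (simp add: scaleR_conv_of_real algebra_simps)
    then show ?thesis
      using u(2) by (intro exI[of _ "real n + u"]) simp
  qed
  have "norm (f 0 (of_nat (Suc n)) - (\<Sum>i\<le>1. f i (of_nat n) * (of_nat (Suc n) - of_nat n) ^ i / fact i))
    \<le> norm (z * (z + 1)) * real n powr (- 2 - Re z) * norm (of_nat (Suc n) - of_nat n :: complex) ^ Suc 1 / fact 1"
  proof (rule complex_Taylor)
    show "convex ?S" by simp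
    fix w assume "w \<in> ?S"
    then obtain t where t: "w = of_real t" "real n \<le> t"
      using S by blast
    have w: "w \<notin> \<real>\<^sub>\<le>\<^sub>0"
      using t assms(1) by (auto simp: complex_nonpos_Reals_iff)
    show "(f i has_field_derivative f (Suc i) w) (at w within ?S)" if "i \<le> 1" for i
    proof -
      have "(f i has_field_derivative f (Suc i) w) (at w)"
      proof (cases "i = 0")
        case True
        then show ?thesis
          using has_field_derivative_powr[OF w, of "- z"] by (simp add: f_def)
      next
        case False
        then have i: "i = 1" using that by simp
        have "((\<lambda>w. - z * w powr (- z - 1)) has_field_derivative - z * ((- z - 1) * w powr (- z - 1 - 1))) (at w)"
          by (intro DERIV_cmult has_field_derivative_powr w)
        also have "- z - 1 - 1 = - 2 - z"
          by simp
        also have "- z * ((- z - 1) * w powr (- 2 - z)) = f (Suc i) w"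
          by (simp add: f_def i algebra_simps)
        finally show ?thesis
          by (simp add: f_def i)
      qed
      then show ?thesis
        by (rule has_field_derivative_at_within)
    qed
    have "norm (w powr (- 2 - z)) = t powr (- 2 - Re z)"
      using t assms(1) by (subst norm_powr_real_powr) auto
    also have "\<dots> \<le> real n powr (- 2 - Re z)"
      using t assms by (intro powr_mono2') auto
    finally show "norm (f (Suc 1) w) \<le> norm (z * (z + 1)) * real n powr (- 2 - Re z)"
      by (simp add: f_def norm_mult mult_left_mono)
  qed auto
  also have "f 0 (of_nat (Suc n)) - (\<Sum>i\<le>1. f i (of_nat n) * (of_nat (Suc n) - of_nat n) ^ i / fact i)
    = z * of_nat n powr (- 1 - z) - of_nat n powr (- z) + of_nat (Suc n) powr (- z)"
  proof -
    have "- z - 1 = - 1 - z" by simp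
    then show ?thesis
      unfolding f_def by (simp only:) (simp add: algebra_simps)
  qed
  finally show ?thesis
    by simp
qed

text \<open>The function \<open>z \<zeta>(1 + z)\<close>, continued analytically to \<open>Re z > -1\<close> by comparing each
  summand with the integral of \<open>x powr (- 1 - z)\<close> over \<open>[n, n + 1]\<close>.\<close>

definition zeta_reg :: "complex \<Rightarrow> complex" where
  "zeta_reg z = 1 + (\<Sum>n. z * of_nat (Suc n) powr (- 1 - z) - of_nat (Suc n) powr (- z)
     + of_nat (Suc (Suc n)) powr (- z))"

lemma zeta_reg_holomorphic: "zeta_reg holomorphic_on {z. Re z > -1}"
proof -
  define f where "f = (\<lambda>n z. z * of_nat (Suc n) powr (- 1 - z) - of_nat (Suc n) powr (- z)
     + of_nat (Suc (Suc n)) powr (- z) :: complex)"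
  have "(\<lambda>z. \<Sum>n. f n z) holomorphic_on {z. Re z > -1}"
  proof (rule holomorphic_uniform_sequence[where f = "\<lambda>N z. \<Sum>n<N. f n z"])
    show "open {z. Re z > -1}"
      by (rule open_halfspace_Re_gt)
    show "(\<lambda>z. \<Sum>n<N. f n z) holomorphic_on {z. Re z > -1}" for N
      unfolding f_def by (intro holomorphic_intros) (auto simp del: of_nat_Suc)
    fix z0 assume "z0 \<in> {z. Re z > -1}"
    \<comment> \<open>Half the distance from \<open>z0\<close> to the line \<open>Re z = -1\<close>,
      so that on the closed ball the exponent \<open>- 2 - Re z\<close> is at most
      \<open>- 1 - d\<close>, uniformly summable.\<close>
    define d where "d = (Re z0 + 1) / 2"
    have d: "d > 0"
      using \<open>z0 \<in> _\<close> by (simp add: d_def)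
    have Re: "Re z \<ge> -1 + d" if "z \<in> cball z0 d" for z
    proof -
      have "Re z0 - Re z \<le> norm (z0 - z)"
        using complex_Re_le_cmod[of "z0 - z"] by simp
      then show ?thesis
        using that by (simp add: dist_norm d_def field_simps)
    qed
    define C where "C = (norm z0 + d) * (norm z0 + d + 1)"
    have "norm (f n z) \<le> C * real (Suc n) powr (- 1 - d)" if z: "z \<in> cball z0 d" for n z
    proof -
      have "norm z \<le> norm z0 + norm (z - z0)"
        using norm_triangle_ineq[of z0 "z - z0"] by simp
      then have nz: "norm z \<le> norm z0 + d"
        using z by (simp add: dist_norm norm_minus_commute)
      have nz1: "norm (z + 1) \<le> norm z0 + d + 1"
        using norm_triangle_ineq[of z 1] nz by simp
      have "norm (f n z) \<le> norm (z * (z + 1)) * real (Suc n) powr (- 2 - Re z)"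
        unfolding f_def using Re[OF z] d by (intro norm_zeta_summand_le) auto
      also have "\<dots> \<le> C * real (Suc n) powr (- 1 - d)"
        unfolding C_def norm_mult using Re[OF z] d nz nz1
        by (intro mult_mono powr_mono) auto
      finally show ?thesis .
    qed
    moreover have "summable (\<lambda>n. C * real (Suc n) powr (- 1 - d))"
      using summable_on_powr[OF d, of UNIV, THEN summable_on_imp_summable]
      by (intro summable_mult) (subst summable_Suc_iff)
    ultimately have "uniform_limit (cball z0 d) (\<lambda>N z. \<Sum>n<N. f n z) (\<lambda>z. \<Sum>n. f n z) sequentially"
      by (rule Weierstrass_m_test)
    moreover have "cball z0 d \<subseteq> {z. Re z > -1}"
      using Re d by force
    ultimately show "\<exists>d>0. cball z0 d \<subseteq> {z. Re z > -1} \<and>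
        uniform_limit (cball z0 d) (\<lambda>N z. \<Sum>n<N. f n z) (\<lambda>z. \<Sum>n. f n z) sequentially"
      using d by blast
  qed
  then have "(\<lambda>z. 1 + (\<Sum>n. f n z)) holomorphic_on {z. Re z > -1}"
    by (intro holomorphic_intros)
  then show ?thesis
    by (simp add: zeta_reg_def[abs_def] f_def)
qed

text \<open>To the right of the line the series may be split: the first summands give
  \<open>z * zeta (1 + z)\<close>, and the differences of powers telescope to -1, which the leading
  1 in \<open>zeta_reg\<close> compensates.\<close>

lemma zeta_reg_eq:
  assumes "Re z > 0"
  shows "zeta_reg z = z * zeta (1 + z)"
proof -
  have "(\<lambda>n. of_nat n powr (- (1 + z)) :: complex) sums zeta (1 + z)"
    unfolding zeta_def using assms by (intro has_sum_imp_sums has_sum_infsum summable_on_dirichlet) auto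
  then have "(\<lambda>n. of_nat (Suc n) powr (- (1 + z)) :: complex) sums zeta (1 + z)"
    by (subst sums_Suc_iff) simp
  then have 1: "(\<lambda>n. z * of_nat (Suc n) powr (- 1 - z)) sums (z * zeta (1 + z))"
    by (intro sums_mult) (simp del: of_nat_Suc)
  have "(\<lambda>n. of_nat (Suc n) powr (- z) :: complex) \<longlonglongrightarrow> 0"
  proof (rule tendsto_norm_zero_cancel)
    have "(\<lambda>n. real (Suc n) powr (- Re z)) \<longlonglongrightarrow> 0"
      using assms by (intro tendsto_neg_powr filterlim_compose[OF filterlim_real_sequentially] filterlim_Suc) auto
    then show "(\<lambda>n. norm (of_nat (Suc n) powr (- z) :: complex)) \<longlonglongrightarrow> 0"
      by (simp add: norm_of_nat_powr del: of_nat_Suc)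
  qed
  from telescope_sums[OF this]
  have 2: "(\<lambda>n. of_nat (Suc (Suc n)) powr (- z) - of_nat (Suc n) powr (- z) :: complex) sums (- 1)"
    by (simp del: of_nat_Suc add: of_nat_Suc[of 0])
  have "(\<lambda>n. z * of_nat (Suc n) powr (- 1 - z) - of_nat (Suc n) powr (- z)
     + of_nat (Suc (Suc n)) powr (- z)) sums (z * zeta (1 + z) + - 1)"
    using sums_add[OF 1 2] by (simp add: algebra_simps del: of_nat_Suc)
  then show ?thesis
    unfolding zeta_reg_def by (simp add: sums_iff del: of_nat_Suc)
qed

lemma zeta_reg_0: "zeta_reg 0 = 1"
  by (simp add: zeta_reg_def del: of_nat_Suc)

section \<open>The 3-4-1 inequality and the absence of zeros on the boundary line\<close>

text \<open>This is the local factor of the 3-4-1 inequality, with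
  \<open>r = p powr (- \<sigma>)\<close> and \<open>u = p powr (- \<i> t)\<close>. After taking
  logarithms, each term of the power series has real part of the sign of -(3 + 4 cos x + cos 2x),
  which is at most 0.\<close>

lemma three_four_one_factor_le:
  fixes r :: real and u :: complex
  assumes "0 \<le> r" "r < 1" "norm u = 1"
  shows "norm (1 - of_real r :: complex) ^ 3 * norm (1 - of_real r * u) ^ 4 * norm (1 - of_real r * u\<^sup>2) \<le> 1"
proof -
  define L where "L = 3 * Ln (1 - of_real r) + 4 * Ln (1 - of_real r * u) + Ln (1 - of_real r * u\<^sup>2)"
  have ser: "(\<lambda>n. - (w ^ n) / of_nat n) sums Ln (1 - w)" if "norm w < 1" for w :: complex
    using Ln_series'[of "- w"] that by simp
  have lt: "norm (of_real r :: complex) < 1" "norm (of_real r * u) < 1" "norm (of_real r * u\<^sup>2) < 1"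
    using assms by (auto simp: norm_mult norm_power)
  have sums: "(\<lambda>n. 3 * (- (of_real r ^ n) / of_nat n) + 4 * (- ((of_real r * u) ^ n) / of_nat n)
      + - ((of_real r * u\<^sup>2) ^ n) / of_nat n) sums L"
    unfolding L_def by (intro sums_add sums_mult ser lt)
  have "Re L \<le> 0"
  proof (rule sums_le[OF _ sums_Re[OF sums] sums_zero])
    fix n
    define v where "v = u ^ n"
    have v: "norm v = 1"
      using assms by (simp add: v_def norm_power)
    have "(Re v)\<^sup>2 + (Im v)\<^sup>2 = 1"
      using v by (simp add: cmod_def)
    \<comment> \<open>On the unit circle the real part of the square of \<open>v\<close> is twice
      the square of \<open>Re v\<close>, minus 1.\<close>
    then have "Re (3 + 4 * v + v\<^sup>2) = 2 * (1 + Re v)\<^sup>2"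
      by (simp add: power2_eq_square algebra_simps)
    then have nonneg: "Re (3 + 4 * v + v\<^sup>2) \<ge> 0"
      by simp
    have "3 * (- (of_real r ^ n) / of_nat n) + 4 * (- ((of_real r * u) ^ n) / of_nat n)
      + - ((of_real r * u\<^sup>2) ^ n) / of_nat n = of_real (- (r ^ n / n)) * (3 + 4 * v + v\<^sup>2)"
      by (simp add: v_def power_mult_distrib power_mult [symmetric] mult.commute[of 2]
          algebra_simps add_divide_distrib diff_divide_distrib)
    then show "Re (3 * (- (of_real r ^ n) / of_nat n) + 4 * (- ((of_real r * u) ^ n) / of_nat n)
      + - ((of_real r * u\<^sup>2) ^ n) / of_nat n) \<le> 0"
      using nonneg assms by (simp only: Re_complex_of_real times_complex.sel) (simp add: mult_nonpos_nonneg)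
  qed
  have norm_eq: "norm (1 - w) = exp (Re (Ln (1 - w)))" if "norm w < 1" for w :: complex
    using that by (subst norm_exp_eq_Re [symmetric], subst exp_Ln) auto
  have "norm (1 - of_real r :: complex) ^ 3 * norm (1 - of_real r * u) ^ 4 * norm (1 - of_real r * u\<^sup>2) = exp (Re L)"
    unfolding norm_eq[OF lt(1)] norm_eq[OF lt(2)] norm_eq[OF lt(3)] L_def
    by (simp add: exp_add exp_of_nat_mult [symmetric])
  then show ?thesis
    using \<open>Re L \<le> 0\<close> by simp
qed

text \<open>Multiplying the local inequalities over \<open>p \<le> N\<close> bounds the partial
  products \<open>E\<close>. Since each \<open>zeta (s j) * E j N\<close> tends to 1, the bound
  passes to the limit and yields a lower bound for the zeta values.\<close>

lemma zeta_three_four_one: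
  assumes "\<sigma> > 1"
  shows "norm (zeta (of_real \<sigma>)) ^ 3 * norm (zeta (of_real \<sigma> + \<i> * of_real t)) ^ 4 *
    norm (zeta (of_real \<sigma> + \<i> * of_real (2 * t))) \<ge> 1"
proof -
  define s where "s = (\<lambda>j. of_real \<sigma> + \<i> * of_real (real j * t))"
  define E where "E = (\<lambda>j N. \<Prod>p | prime p \<and> p \<le> N. 1 - of_nat p powr (- s j))"
  have lim: "(\<lambda>N. zeta (s j) * E j N) \<longlonglongrightarrow> 1" for j
    unfolding E_def using assms by (intro euler_product_zeta) (simp add: s_def)
  have "(\<lambda>N. norm (zeta (s 0) * E 0 N) ^ 3 * norm (zeta (s 1) * E 1 N) ^ 4 * norm (zeta (s 2) * E 2 N))
    \<longlonglongrightarrow> norm (1::complex) ^ 3 * norm (1::complex) ^ 4 * norm (1::complex)"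
    by (intro tendsto_intros lim)
  moreover have "norm (zeta (s 0) * E 0 N) ^ 3 * norm (zeta (s 1) * E 1 N) ^ 4 * norm (zeta (s 2) * E 2 N)
    \<le> norm (zeta (s 0)) ^ 3 * norm (zeta (s 1)) ^ 4 * norm (zeta (s 2))" for N
  proof -
    let ?P = "{p. prime p \<and> p \<le> N}"
    have "norm (E 0 N) ^ 3 * norm (E 1 N) ^ 4 * norm (E 2 N)
      = (\<Prod>p\<in>?P. norm (1 - of_nat p powr (- s 0)) ^ 3 * norm (1 - of_nat p powr (- s 1)) ^ 4
          * norm (1 - of_nat p powr (- s 2)))"
      by (simp add: E_def prod_norm [symmetric] prod_power_distrib prod.distrib)
    also have "\<dots> \<le> 1"
    proof (rule prod_le_1, safe)
      fix p :: nat assume p: "prime p"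
      define u where "u = (of_nat p powr (- (\<i> * of_real t)) :: complex)"
      define r where "r = real p powr (- \<sigma>)"
      have p1: "p > 1" using p prime_gt_1_nat by blast
      have r: "(of_nat p powr (- of_real \<sigma>) :: complex) = of_real r"
        unfolding r_def using powr_of_real[of "real p" "- \<sigma>"] by simp
      have "s 0 = of_real \<sigma>" "s 1 = of_real \<sigma> + \<i> * of_real t"
        "s 2 = of_real \<sigma> + (\<i> * of_real t + \<i> * of_real t)"
        by (simp_all add: s_def)
      then have "of_nat p powr (- s 0) = (of_real r :: complex)"
        "of_nat p powr (- s 1) = of_real r * u"
        "of_nat p powr (- s 2) = of_real r * u\<^sup>2"
        by (simp_all only: r [symmetric] u_def power2_eq_square powr_add [symmetric] minus_add_distrib)
      moreover have "r < 1"
        unfolding r_def using p1 assms by (simp add: powr_less_one)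
      moreover have "norm u = 1"
        using p1 by (simp add: u_def norm_of_nat_powr)
      ultimately show "norm (1 - of_nat p powr (- s 0)) ^ 3 * norm (1 - of_nat p powr (- s 1)) ^ 4
          * norm (1 - of_nat p powr (- s 2)) \<le> 1"
        using three_four_one_factor_le[of r u] by (simp add: r_def)
    qed auto
    finally have "norm (E 0 N) ^ 3 * norm (E 1 N) ^ 4 * norm (E 2 N) \<le> 1" .
    then have "(norm (zeta (s 0)) ^ 3 * norm (zeta (s 1)) ^ 4 * norm (zeta (s 2))) *
       (norm (E 0 N) ^ 3 * norm (E 1 N) ^ 4 * norm (E 2 N))
      \<le> (norm (zeta (s 0)) ^ 3 * norm (zeta (s 1)) ^ 4 * norm (zeta (s 2))) * 1"
      by (intro mult_left_mono) auto
    then show ?thesis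
      by (simp add: norm_mult power_mult_distrib mult_ac)
  qed
  ultimately have "norm (1::complex) ^ 3 * norm (1::complex) ^ 4 * norm (1::complex)
    \<le> norm (zeta (s 0)) ^ 3 * norm (zeta (s 1)) ^ 4 * norm (zeta (s 2))"
    by (intro LIMSEQ_le_const2) auto
  then show ?thesis
    by (simp add: s_def)
qed

text \<open>A zero at \<open>\<i> t\<close> with \<open>t \<noteq> 0\<close> would enter the 3-4-1
  product to the fourth power, against only the third power of the pole of zeta at 1. The product
  would then tend to 0 as \<open>x\<close> decreases to 0, although it is at least 1.\<close>

lemma zeta_reg_nonzero_imaginary: "zeta_reg (\<i> * of_real t) \<noteq> 0"
proof (cases "t = 0")
  case True
  then show ?thesis by (simp add: zeta_reg_0)
next
  case False
  show ?thesis
  proof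
    assume zero: "zeta_reg (\<i> * of_real t) = 0"
    have diff: "zeta_reg field_differentiable at z" if "Re z > -1" for z
      using zeta_reg_holomorphic open_halfspace_Re_gt[of "-1"] that
      by (auto simp: holomorphic_on_open field_differentiable_def)
    have cont: "((\<lambda>x. zeta_reg (of_real x + \<i> * of_real \<tau>)) \<longlongrightarrow> zeta_reg (\<i> * of_real \<tau>)) (at_right 0)" for \<tau>
    proof -
      have "isCont zeta_reg (\<i> * of_real \<tau>)"
        using diff by (intro field_differentiable_imp_continuous_at) auto
      moreover have "((\<lambda>x. of_real x + \<i> * of_real \<tau>) \<longlongrightarrow> \<i> * of_real \<tau>) (at_right (0::real))"
        by (auto intro!: tendsto_eq_intros)
      ultimately show ?thesis
        by (rule isCont_tendsto_compose)
    qed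
    obtain D where "(zeta_reg has_field_derivative D) (at (\<i> * of_real t))"
      using diff[of "\<i> * of_real t"] by (auto simp: field_differentiable_def)
    then have "((\<lambda>h. zeta_reg (\<i> * of_real t + h) / h) \<longlongrightarrow> D) (at 0)"
      by (simp add: DERIV_def zero)
    moreover have "filterlim (of_real :: real \<Rightarrow> complex) (at 0) (at_right 0)"
      by (auto simp: filterlim_at eventually_at_filter intro!: tendsto_eq_intros)
    ultimately have quot: "((\<lambda>x. zeta_reg (of_real x + \<i> * of_real t) / of_real x) \<longlongrightarrow> D) (at_right 0)"
      by (drule_tac filterlim_compose) (auto simp: add.commute)
    \<comment> \<open>This is the 3-4-1 product at \<open>1 + x\<close> rewritten through
      \<open>zeta_reg\<close>. The pole contributes x^(-3) and the assumed zero x^4; the single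
      factor \<open>x\<close> left over forces the limit 0, all other factors having finite
      limits.\<close>
    define F where "F = (\<lambda>x::real. norm (zeta_reg (of_real x + \<i> * of_real 0)) ^ 3 *
        norm (zeta_reg (of_real x + \<i> * of_real t) / of_real x) ^ 4 * x *
        norm (zeta_reg (of_real x + \<i> * of_real (2 * t))) /
        (norm (of_real x + \<i> * of_real t :: complex) ^ 4 * norm (of_real x + \<i> * of_real (2 * t) :: complex)))"
    have "(F \<longlongrightarrow> norm (zeta_reg (\<i> * of_real 0)) ^ 3 * norm D ^ 4 * 0 * norm (zeta_reg (\<i> * of_real (2 * t))) /
        (norm (of_real 0 + \<i> * of_real t :: complex) ^ 4 * norm (of_real 0 + \<i> * of_real (2 * t) :: complex))) (at_right 0)"
      unfolding F_def using False by (intro tendsto_intros cont quot) auto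
    then have lim: "(F \<longlongrightarrow> 0) (at_right 0)"
      by simp
    have "\<forall>\<^sub>F x in at_right 0. F x \<ge> 1"
      using eventually_at_right_less[of 0]
    proof eventually_elim
      case (elim x)
      have z: "norm (zeta (of_real (1 + x) + \<i> * of_real \<tau>))
        = norm (zeta_reg (of_real x + \<i> * of_real \<tau>)) / norm (of_real x + \<i> * of_real \<tau> :: complex)" for \<tau>
      proof -
        define w where "w = (of_real x + \<i> * of_real \<tau> :: complex)"
        have "Re w > 0" "w \<noteq> 0"
          using elim by (auto simp: w_def complex_eq_iff)
        then have "zeta (1 + w) = zeta_reg w / w"
          by (simp add: zeta_reg_eq)
        then show ?thesis
          by (simp add: w_def norm_divide add.assoc)
      qed
      have "F x = norm (zeta (of_real (1 + x) + \<i> * of_real 0)) ^ 3 *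
        norm (zeta (of_real (1 + x) + \<i> * of_real t)) ^ 4 *
        norm (zeta (of_real (1 + x) + \<i> * of_real (2 * t)))"
        unfolding z F_def using elim by (simp add: norm_divide power_divide divide_simps power_numeral_reduce)
      then show ?case
        using zeta_three_four_one[of "1 + x" t] elim by simp
    qed
    then have "0 \<ge> (1::real)"
      using lim by (intro tendsto_lowerbound[OF lim]) auto
    then show False by simp
  qed
qed

lemma zeta_reg_nonzero:
  assumes "Re z \<ge> 0"
  shows "zeta_reg z \<noteq> 0"
proof (cases "Re z = 0")
  case True
  then have "z = \<i> * of_real (Im z)"
    by (simp add: complex_eq_iff)
  then show ?thesis
    using zeta_reg_nonzero_imaginary by metis
next
  case False
  then show ?thesis
    using assms zeta_nonzero[of "1 + z"] by (auto simp: zeta_reg_eq)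
qed

section \<open>Newman's contour argument\<close>

lemma has_contour_integral_circlepath_halves:
  assumes "r > 0"
    and "(f has_contour_integral I) (part_circlepath z r 0 pi)"
    and "(f has_contour_integral J) (part_circlepath z r pi (2 * pi))"
  shows "(f has_contour_integral (I + J)) (circlepath z r)"
  using assms unfolding circlepath_def
  by (subst (asm) (1 2) has_contour_integral_part_circlepath_iff, simp, simp,
      subst has_contour_integral_part_circlepath_iff)
    (auto intro: has_integral_combine[of 0 pi "2 * pi"])

text \<open>For \<open>y \<ge> 1\<close> the summand does not decrease, so the integral comparison
  covers all terms but the last, which is added separately. For \<open>y < 1\<close> it decreases,
  and the comparison covers every term.\<close>

lemma sum_powr_le:
  fixes y :: real
  assumes "y > 0" "N \<ge> 1"
  shows "(\<Sum>n=1..N. real n powr (y - 1)) \<le> real N powr y / y + real N powr (y - 1)"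
proof (cases "y \<ge> 1")
  case True
  show ?thesis
    using assms(2)
  proof (induction N rule: dec_induct)
    case base
    then show ?case using assms by simp
  next
    case (step N)
    obtain \<xi> where \<xi>: "real N < \<xi>" "\<xi> < real N + 1"
      "(real N + 1) powr y - real N powr y = y * \<xi> powr (y - 1)"
      by (rule powr_increment_mvt[of "real N" y]) (use step.hyps in auto)
    have "real N powr (y - 1) \<le> \<xi> powr (y - 1)"
      using \<xi> True by (intro powr_mono2) auto
    also have "\<dots> = ((real N + 1) powr y - real N powr y) / y"
      using \<xi>(3) assms(1) by simp
    finally have "real N powr y / y + real N powr (y - 1) \<le> real (Suc N) powr y / y"
      by (simp add: diff_divide_distrib add.commute)
    then show ?case
      using step.IH by simp
  qed
next
  case False
  have "(\<Sum>n=1..N. real n powr (y - 1)) \<le> real N powr y / y"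
    using assms(2)
  proof (induction N rule: dec_induct)
    case base
    then show ?case using assms False by (simp add: field_simps)
  next
    case (step N)
    obtain \<xi> where \<xi>: "real N < \<xi>" "\<xi> < real N + 1"
      "(real N + 1) powr y - real N powr y = y * \<xi> powr (y - 1)"
      by (rule powr_increment_mvt[of "real N" y]) (use step.hyps in auto)
    have "(real N + 1) powr (y - 1) \<le> \<xi> powr (y - 1)"
      using \<xi> False by (intro powr_mono2') auto
    also have "\<dots> = ((real N + 1) powr y - real N powr y) / y"
      using \<xi>(3) assms(1) by simp
    finally have "real N powr y / y + real (Suc N) powr (y - 1) \<le> real (Suc N) powr y / y"
      by (simp add: diff_divide_distrib add.commute)
    then show ?case
      using step.IH by simp
  qed
  then show ?thesis
    by (smt (verit) powr_ge_zero)
qed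

text \<open>Newman's contour argument in the rotated variable \<open>w = \<i> z\<close>, which puts the boundary line
  \<open>Re z = 0\<close> on the real axis.\<close>

definition moebius_partial :: "nat \<Rightarrow> complex \<Rightarrow> complex" where
  "moebius_partial N w = (\<Sum>n=1..N. of_int (moebius_mu n) * of_nat n powr (- 1 + \<i> * w))"

text \<open>Above the real axis the subtracted quotient equals
  \<open>1 / zeta (1 - \<i> * w)\<close>, the full Moebius series, so the difference is its tail
  beyond \<open>N\<close>. The identity \<open>Re (1 - \<i> * w) - 1 = Im w\<close> gives the
  denominator.\<close>

lemma norm_moebius_partial_diff_le:
  assumes "Im w > 0" "N \<ge> 1"
  shows "norm (moebius_partial N w - (- \<i> * w) / zeta_reg (- \<i> * w)) \<le> real N powr (- Im w) / Im w"
proof -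
  define s where "s = 1 - \<i> * w"
  have s: "Re s > 1" using assms by (simp add: s_def)
  have norm_mu: "norm (of_int (moebius_mu n) :: complex) \<le> 1" for n
    using moebius_mu_cases[of n] by auto
  let ?f = "\<lambda>n. of_int (moebius_mu n) * of_nat n powr (- s) :: complex"
  have "zeta_reg (- \<i> * w) = (- \<i> * w) * zeta s"
    using assms zeta_reg_eq[of "- \<i> * w"] by (simp add: s_def)
  moreover have "w \<noteq> 0"
    using assms by auto
  ultimately have "(- \<i> * w) / zeta_reg (- \<i> * w) = 1 / zeta s"
    by simp
  also have "\<dots> = infsum ?f UNIV"
    using moebius_dirichlet_mult_zeta[OF s] zeta_nonzero[OF s] by (simp add: field_simps)
  also have "\<dots> = infsum ?f ({1..N} \<union> {N<..})"
    by (rule infsum_cong_neutral) auto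
  also have "\<dots> = infsum ?f {1..N} + infsum ?f {N<..}"
    using s norm_mu by (intro infsum_Un_disjoint summable_on_bounded_dirichlet) auto
  also have "infsum ?f {1..N} = moebius_partial N w"
    by (simp add: moebius_partial_def s_def)
  finally have "moebius_partial N w - (- \<i> * w) / zeta_reg (- \<i> * w) = - infsum ?f {N<..}"
    by simp
  then show ?thesis
    using norm_infsum_dirichlet_tail_le[OF s norm_mu assms(2), of "{N<..}"] by (simp add: s_def)
qed

text \<open>Below the axis no limit function is available for comparison, but a finite Dirichlet
  polynomial is entire and can be estimated term by term.\<close>

lemma norm_moebius_partial_le:
  assumes "Im w < 0" "N \<ge> 1"
  shows "norm (moebius_partial N w) \<le> real N powr (- Im w) / (- Im w) + real N powr (- Im w - 1)"
proof -
  have "norm (moebius_partial N w) \<le> (\<Sum>n=1..N. real n powr (- Im w - 1))"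
    unfolding moebius_partial_def
  proof (rule sum_norm_le)
    fix n
    have "norm (of_int (moebius_mu n) :: complex) \<le> 1"
      using moebius_mu_cases[of n] by auto
    then have "norm (of_int (moebius_mu n) :: complex) * real n powr (- Im w - 1) \<le> 1 * real n powr (- Im w - 1)"
      by (intro mult_right_mono) auto
    then show "norm (of_int (moebius_mu n) * of_nat n powr (- 1 + \<i> * w) :: complex) \<le> real n powr (- Im w - 1)"
      by (simp add: norm_mult norm_of_nat_powr)
  qed
  also have "\<dots> \<le> real N powr (- Im w) / (- Im w) + real N powr (- Im w - 1)"
    using assms by (intro sum_powr_le) auto
  finally show ?thesis .
qed

text \<open>On the circle \<open>w * cnj w\<close> is the square of \<open>R\<close>, which turns
  the kernel into a multiple of \<open>cnj w - w\<close>. Its zero at \<open>Im w = 0\<close>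
  cancels the factor \<open>1 / Im w\<close> in the estimates on both arcs; this is the purpose of
  Newman's modified Cauchy kernel.\<close>

lemma norm_newman_kernel:
  assumes "norm w = R" "R > 0"
  shows "norm ((1 - w\<^sup>2 / of_real R ^ 2) / w) = 2 * \<bar>Im w\<bar> / R\<^sup>2"
proof -
  have w: "w \<noteq> 0" using assms by auto
  have RR: "w * cnj w = of_real R ^ 2"
    using assms by (simp add: complex_norm_square [symmetric])
  have "(1 - w\<^sup>2 / of_real R ^ 2) / w = (cnj w - w) / of_real R ^ 2"
    unfolding RR [symmetric] using w by (simp add: field_simps power2_eq_square)
  also have "cnj w - w = - (2 * \<i> * of_real (Im w))"
    by (simp add: complex_eq_iff)
  finally show ?thesis
    by (simp add: norm_divide norm_mult norm_power)
qed

text \<open>A Riemann-Lebesgue estimate by one integration by parts: differentiating the oscillating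
  power of \<open>N\<close> produces \<open>ln N\<close>, and the boundary terms vanish because
  \<open>H\<close> is zero at both endpoints.\<close>

lemma linepath_oscillating_integral_bound:
  assumes "open U" "H holomorphic_on U" "closed_segment (- of_real R) (of_real R) \<subseteq> U"
    and "H (- of_real R) = 0" "H (of_real R) = 0" "R > 0"
  obtains B where "\<And>N. N \<ge> 2 \<Longrightarrow>
    norm (contour_integral (linepath (- of_real R) (of_real R)) (\<lambda>w. H w * of_nat N powr (- \<i> * w))) \<le> B / ln (real N)"
proof -
  let ?l = "linepath (- of_real R) (of_real R) :: real \<Rightarrow> complex"
  let ?S = "closed_segment (- of_real R) (of_real R) :: complex set"
  have holH': "deriv H holomorphic_on U"
    using assms by (intro holomorphic_deriv)
  have contH: "continuous_on ?S H" and contH': "continuous_on ?S (deriv H)"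
    using assms(2,3) holH' by (auto intro: holomorphic_on_imp_continuous_on holomorphic_on_subset)
  have "compact (deriv H ` ?S)"
    using contH' by (intro compact_continuous_image) auto
  then obtain C where C: "\<And>w. w \<in> ?S \<Longrightarrow> norm (deriv H w) \<le> C" and "C > 0"
    using compact_imp_bounded bounded_pos by (metis imageI)
  have real: "Im w = 0" if w: "w \<in> ?S" for w
  proof -
    obtain u where "w = (1 - u) *\<^sub>R (- of_real R) + u *\<^sub>R of_real R"
      using w by (auto simp: closed_segment_def)
    then show ?thesis by simp
  qed
  show ?thesis
  proof (rule that)
    fix N :: nat assume N: "N \<ge> 2"
    define \<Lambda> where "\<Lambda> = complex_of_real (ln (real N))"
    have \<Lambda>: "\<Lambda> \<noteq> 0" "norm \<Lambda> = ln (real N)"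
      using N by (auto simp: \<Lambda>_def)
    define E where "E = (\<lambda>w. of_nat N powr (- \<i> * w) :: complex)"
    have E_exp: "E = (\<lambda>w. exp (- \<i> * w * \<Lambda>))"
      using N by (auto simp: E_def powr_def \<Lambda>_def Ln_of_nat)
    have normE: "norm (E w) = 1" if "w \<in> ?S" for w
      using real[OF that] N by (simp add: E_def norm_of_nat_powr)
    have contE: "continuous_on ?S E"
      unfolding E_exp by (intro continuous_intros)
    have der: "((\<lambda>w. H w * E w) has_field_derivative (deriv H w * E w + (- \<i> * \<Lambda>) * (H w * E w))) (at w within ?S)"
      if "w \<in> ?S" for w
    proof -
      have 1: "(H has_field_derivative deriv H w) (at w)"
        using assms that by (intro holomorphic_derivI[of H U]) auto
      have 2: "(E has_field_derivative (- \<i> * \<Lambda>) * E w) (at w)"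
        unfolding E_exp by (auto intro!: derivative_eq_intros)
      show ?thesis
        by (rule has_field_derivative_at_within, rule DERIV_cong[OF DERIV_mult[OF 1 2]]) algebra
    qed
    have "((\<lambda>w. deriv H w * E w + (- \<i> * \<Lambda>) * (H w * E w)) has_contour_integral
        (H (pathfinish ?l) * E (pathfinish ?l) - H (pathstart ?l) * E (pathstart ?l))) ?l"
      by (rule contour_integral_primitive[where S = ?S]) (use der in auto)
    then have 1: "((\<lambda>w. deriv H w * E w + (- \<i> * \<Lambda>) * (H w * E w)) has_contour_integral 0) ?l"
      using assms by simp
    have "(\<lambda>w. deriv H w * E w) contour_integrable_on ?l"
      using contH' contE by (intro contour_integrable_continuous_linepath continuous_intros)
    then have I': "((\<lambda>w. deriv H w * E w) has_contour_integral contour_integral ?l (\<lambda>w. deriv H w * E w)) ?l"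
      by (rule has_contour_integral_integral)
    have "(\<lambda>w. H w * E w) contour_integrable_on ?l"
      using contH contE by (intro contour_integrable_continuous_linepath continuous_intros)
    then have "((\<lambda>w. H w * E w) has_contour_integral contour_integral ?l (\<lambda>w. H w * E w)) ?l"
      by (rule has_contour_integral_integral)
    then have 2: "((\<lambda>w. deriv H w * E w + (- \<i> * \<Lambda>) * (H w * E w)) has_contour_integral
        (contour_integral ?l (\<lambda>w. deriv H w * E w) + (- \<i> * \<Lambda>) * contour_integral ?l (\<lambda>w. H w * E w))) ?l"
      by (intro has_contour_integral_add has_contour_integral_lmul I')
    have "contour_integral ?l (\<lambda>w. deriv H w * E w) = \<i> * \<Lambda> * contour_integral ?l (\<lambda>w. H w * E w)"
      using contour_integral_unique[OF 1] contour_integral_unique[OF 2] by simp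
    then have "ln (real N) * norm (contour_integral ?l (\<lambda>w. H w * E w)) = norm (contour_integral ?l (\<lambda>w. deriv H w * E w))"
      using \<Lambda> by (simp add: norm_mult)
    also have "\<dots> \<le> C * norm (of_real R - (- of_real R) :: complex)"
      using \<open>C > 0\<close> C normE
      by (intro has_contour_integral_bound_linepath[OF I']) (auto simp: norm_mult)
    finally show "norm (contour_integral ?l (\<lambda>w. H w * of_nat N powr (- \<i> * w)))
      \<le> (C * norm (of_real R - (- of_real R) :: complex)) / ln (real N)"
      unfolding E_def using N by (simp add: field_simps)
  qed
qed

text \<open>Cauchy's formula on the full circle expresses the partial sum at 0. On the lower arc it
  is bounded directly. On the upper arc it is replaced by its limit function, whose integral is
  moved to the diameter and is \<open>O(1 / ln N)\<close> there. Each arc costs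
  \<open>2 * pi / R\<close>; the lower one adds \<open>2 * pi / N\<close>.\<close>

lemma newman_moebius_bound:
  assumes R: "R > 0"
  obtains B where "\<And>N. N \<ge> 2 \<Longrightarrow>
    2 * pi * \<bar>\<Sum>n=1..N. real_of_int (moebius_mu n) / real n\<bar> \<le> 4 * pi / R + 2 * pi / real N + B / ln (real N)"
proof -
  \<comment> \<open>The limit function times the kernel, with the common factor \<open>w\<close>
    cancelled. Thus \<open>H\<close> has no pole at 0, and it vanishes at both ends of the
    diameter.\<close>
  define H where "H = (\<lambda>w. - \<i> * (1 - w\<^sup>2 / of_real R ^ 2) / zeta_reg (- \<i> * w))"
  \<comment> \<open>An open set containing the closed upper half-plane, by non-vanishing for
    \<open>Re z \<ge> 0\<close>. It is a neighbourhood of the diameter, as needed to differentiate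
    \<open>H\<close> there.\<close>
  define U where "U = {w. Im w > -1} \<inter> (\<lambda>w. zeta_reg (- \<i> * w)) -` (- {0})"
  have hol0: "(\<lambda>w. zeta_reg (- \<i> * w)) holomorphic_on {w. Im w > -1}"
  proof -
    have "(zeta_reg \<circ> (\<lambda>w. - \<i> * w)) holomorphic_on {w. Im w > -1}"
      by (rule holomorphic_on_compose_gen[OF _ zeta_reg_holomorphic]) (auto intro!: holomorphic_intros)
    then show ?thesis by (simp add: o_def)
  qed
  have openU: "open U"
    unfolding U_def
    by (intro continuous_open_preimage holomorphic_on_imp_continuous_on hol0 open_halfspace_Im_gt) auto
  have holH: "H holomorphic_on U"
    unfolding H_def using R
    by (intro holomorphic_intros holomorphic_on_subset[OF hol0]) (auto simp: U_def)
  have upperU: "w \<in> U" if "Im w \<ge> 0" for w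
    using zeta_reg_nonzero[of "- \<i> * w"] that by (auto simp: U_def)
  have segment: "Im w \<ge> 0" if w: "w \<in> closed_segment (- of_real R) (of_real R)" for w
  proof -
    obtain u where "w = (1 - u) *\<^sub>R (- of_real R) + u *\<^sub>R of_real R"
      using w by (auto simp: closed_segment_def)
    then show ?thesis by simp
  qed
  let ?l = "linepath (- of_real R) (of_real R) :: real \<Rightarrow> complex"
  let ?up = "part_circlepath 0 R 0 pi" and ?low = "part_circlepath 0 R pi (2 * pi)"
  obtain B where B: "\<And>N. N \<ge> 2 \<Longrightarrow>
    norm (contour_integral ?l (\<lambda>w. H w * of_nat N powr (- \<i> * w))) \<le> B / ln (real N)"
    by (rule linepath_oscillating_integral_bound[OF openU holH, of R])
      (use R segment upperU in \<open>auto simp: H_def power2_eq_square\<close>)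
  have norm_up: "norm w = R" "Im w \<ge> 0" if "w \<in> path_image ?up" for w
    using that R by (auto simp: path_image_part_circlepath' closed_segment_eq_real_ivl norm_mult sin_ge_zero)
  have norm_low: "norm w = R" "Im w \<le> 0" if w: "w \<in> path_image ?low" for w
  proof -
    have "w \<in> (\<lambda>x. of_real R * cis x) ` {pi..2 * pi}"
      using w by (simp add: path_image_part_circlepath' closed_segment_eq_real_ivl)
    then obtain x where x: "w = of_real R * cis x" "x \<in> {pi..2 * pi}"
      by (rule imageE)
    show "norm w = R"
      using x R by (simp add: norm_mult)
    have "sin x \<le> 0"
      using sin_ge_zero[of "x - pi"] x by (simp add: sin_diff)
    then show "Im w \<le> 0"
      using x R by (simp add: mult_nonneg_nonpos)
  qed
  have boundary: "w \<in> {of_real R, - of_real R}" if "norm w = R" "Im w = 0" for w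
  proof -
    have "w = of_real (Re w)" using that by (simp add: complex_eq_iff)
    moreover have "\<bar>Re w\<bar> = R" using that by (simp add: cmod_def)
    ultimately show ?thesis by (auto simp: abs_if split: if_splits)
  qed
  show ?thesis
  proof (rule that)
    fix N :: nat assume N: "N \<ge> 2"
    define S where "S = moebius_partial N"
    define E where "E = (\<lambda>w. of_nat N powr (- \<i> * w) :: complex)"
    define k where "k = (\<lambda>w. (1 - w\<^sup>2 / of_real R ^ 2) / w :: complex)"
    define f where "f = (\<lambda>w. (- \<i> * w) / zeta_reg (- \<i> * w))"
    have normE: "norm (E w) = real N powr Im w" for w
      by (simp add: E_def norm_of_nat_powr)
    have holS: "S holomorphic_on A" for A
      unfolding S_def moebius_partial_def using N by (intro holomorphic_intros) auto
    have holE: "E holomorphic_on A" for A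
      unfolding E_def using N by (intro holomorphic_intros) auto
    have "((\<lambda>w. (S w * E w * (1 - w\<^sup>2 / of_real R ^ 2)) / (w - 0)) has_contour_integral
        (2 * of_real pi * \<i> * (S 0 * E 0 * (1 - 0\<^sup>2 / of_real R ^ 2)))) (circlepath 0 R)"
      using R by (intro Cauchy_integral_circlepath_simple holomorphic_intros holS holE) auto
    moreover have "E 0 = 1"
      using N by (simp add: E_def)
    ultimately have full: "((\<lambda>w. S w * E w * k w) has_contour_integral (2 * of_real pi * \<i> * S 0)) (circlepath 0 R)"
      by (simp add: k_def mult.assoc)
    have nz_up: "w \<noteq> 0" if "w \<in> path_image ?up \<union> path_image ?low" for w
      using norm_up norm_low that R by fastforce
    have cont: "continuous_on A (\<lambda>w. S w * E w * k w)" if "0 \<notin> A" for A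
      unfolding k_def using that R holS holE
      by (intro continuous_intros) (auto intro: holomorphic_on_imp_continuous_on)
    have int_up: "((\<lambda>w. S w * E w * k w) has_contour_integral contour_integral ?up (\<lambda>w. S w * E w * k w)) ?up"
      and int_low: "((\<lambda>w. S w * E w * k w) has_contour_integral contour_integral ?low (\<lambda>w. S w * E w * k w)) ?low"
      using nz_up by (auto intro!: has_contour_integral_integral contour_integrable_continuous_part_circlepath cont)
    have eq: "2 * of_real pi * \<i> * S 0 = contour_integral ?up (\<lambda>w. S w * E w * k w) + contour_integral ?low (\<lambda>w. S w * E w * k w)"
      using has_contour_integral_circlepath_halves[OF R int_up int_low] full
      by (rule has_contour_integral_unique [symmetric])

    have "continuous_on {w. Im w \<ge> 0} (\<lambda>w. H w * E w)"
      using holH holE upperU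
      by (intro continuous_intros) (auto intro!: holomorphic_on_imp_continuous_on elim: holomorphic_on_subset)
    moreover have "(\<lambda>w. H w * E w) holomorphic_on {w. Im w \<ge> 0}"
      using upperU by (intro holomorphic_intros holE holomorphic_on_subset[OF holH]) auto
    \<comment> \<open>The upper arc runs from \<open>R\<close> to \<open>- R\<close> and the
      diameter leads back, bounding a half-disc inside the region of holomorphy.\<close>
    ultimately have "((\<lambda>w. H w * E w) has_contour_integral 0) (?up +++ ?l)"
      using R norm_up segment
      by (intro Cauchy_theorem_convex_simple[where S = "{w. Im w \<ge> 0}"])
        (auto simp: convex_halfspace_Im_ge path_image_join intro!: valid_path_join)
    moreover have intHup: "(\<lambda>w. H w * E w) contour_integrable_on ?up"
      using norm_up upperU
      by (intro contour_integrable_continuous_part_circlepath holomorphic_on_imp_continuous_on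
          holomorphic_intros holE holomorphic_on_subset[OF holH]) auto
    moreover have intHl: "(\<lambda>w. H w * E w) contour_integrable_on ?l"
      using segment upperU
      by (intro contour_integrable_continuous_linepath holomorphic_on_imp_continuous_on
          holomorphic_intros holE holomorphic_on_subset[OF holH]) auto
    ultimately have "contour_integral ?up (\<lambda>w. H w * E w) + contour_integral ?l (\<lambda>w. H w * E w) = 0"
      by (subst contour_integral_join [symmetric]) (auto dest: contour_integral_unique)
    then have "contour_integral ?up (\<lambda>w. H w * E w) = - contour_integral ?l (\<lambda>w. H w * E w)"
      by (simp add: eq_neg_iff_add_eq_0)
    then have bound_H: "norm (contour_integral ?up (\<lambda>w. H w * E w)) \<le> B / ln (real N)"
      using B[OF N] by (simp add: E_def)

    have "((\<lambda>w. S w * E w * k w - H w * E w) has_contour_integral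
        (contour_integral ?up (\<lambda>w. S w * E w * k w) - contour_integral ?up (\<lambda>w. H w * E w))) ?up"
      by (intro has_contour_integral_diff int_up has_contour_integral_integral intHup)
    then have "norm (contour_integral ?up (\<lambda>w. S w * E w * k w) - contour_integral ?up (\<lambda>w. H w * E w))
        \<le> (2 / R\<^sup>2) * R * (pi - 0)"
    \<comment> \<open>At the two real points the factor \<open>1 / Im w\<close> of the tail estimate
      is meaningless; finitely many points may be excluded.\<close>
    proof (rule has_contour_integral_bound_part_circlepath_strong[where k = "{of_real R, - of_real R}"])
      fix w assume w: "w \<in> path_image ?up - {of_real R, - of_real R}"
      then have y: "Im w > 0" and nw: "norm w = R"
        using norm_up[of w] boundary[of w] by fastforce+
      have "H w = f w * k w"
        using nz_up[of w] w by (simp add: H_def f_def k_def)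
      then have "norm (S w * E w * k w - H w * E w) = norm (S w - f w) * norm (E w) * norm (k w)"
        by (simp add: norm_mult [symmetric] algebra_simps)
      also have "\<dots> \<le> (real N powr (- Im w) / Im w) * norm (E w) * norm (k w)"
        unfolding S_def f_def using norm_moebius_partial_diff_le[OF y, of N] N by (intro mult_right_mono) auto
      also have "\<dots> = (real N powr (- Im w) * real N powr Im w) * (2 / R\<^sup>2)"
        unfolding normE k_def norm_newman_kernel[OF nw R] using y by (simp add: field_simps)
      also have "\<dots> = 2 / R\<^sup>2"
        using N by (simp add: powr_add [symmetric])
      finally show "norm (S w * E w * k w - H w * E w) \<le> 2 / R\<^sup>2" .
    qed (use R in auto)
    also have "(2 / R\<^sup>2) * R * (pi - 0) = 2 * pi / R"
      using R by (simp add: power2_eq_square)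
    finally have bound_up: "norm (contour_integral ?up (\<lambda>w. S w * E w * k w) - contour_integral ?up (\<lambda>w. H w * E w)) \<le> 2 * pi / R" .

    have "norm (contour_integral ?low (\<lambda>w. S w * E w * k w)) \<le> (2 / R\<^sup>2 + 2 / (R * real N)) * R * (2 * pi - pi)"
      using int_low
    proof (rule has_contour_integral_bound_part_circlepath_strong[where k = "{of_real R, - of_real R}"])
      fix w assume w: "w \<in> path_image ?low - {of_real R, - of_real R}"
      define y where "y = - Im w"
      have y: "y > 0" and nw: "norm w = R"
        using norm_low[of w] boundary[of w] w unfolding y_def by fastforce+
      have yR: "y \<le> R"
        using abs_Im_le_cmod[of w] nw by (simp add: y_def)
      have "norm (S w * E w * k w) = norm (S w) * (real N powr (- y) * (2 * y / R\<^sup>2))"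
        unfolding k_def norm_mult norm_newman_kernel[OF nw R] normE using y by (simp add: y_def)
      also have "\<dots> \<le> (real N powr y / y + real N powr (y - 1)) * (real N powr (- y) * (2 * y / R\<^sup>2))"
      proof (rule mult_right_mono)
        show "norm (S w) \<le> real N powr y / y + real N powr (y - 1)"
          using norm_moebius_partial_le[of w N] y N by (simp add: S_def y_def)
      qed (use y in auto)
      also have "real N powr (y - 1) = real N powr y / real N"
        using N by (simp add: powr_diff)
      also have "(real N powr y / y + real N powr y / real N) * (real N powr (- y) * (2 * y / R\<^sup>2))
          = (real N powr y * real N powr (- y)) * (2 / R\<^sup>2 + 2 * y / (R\<^sup>2 * real N))"
        using y N R by (simp add: field_simps)
      also have "real N powr y * real N powr (- y) = 1"
        using N by (simp add: powr_add [symmetric])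
      also have "1 * (2 / R\<^sup>2 + 2 * y / (R\<^sup>2 * real N)) \<le> 2 / R\<^sup>2 + 2 * R / (R\<^sup>2 * real N)"
        using yR R N by (simp add: divide_right_mono)
      also have "2 * R / (R\<^sup>2 * real N) = 2 / (R * real N)"
        using R by (simp add: power2_eq_square)
      finally show "norm (S w * E w * k w) \<le> 2 / R\<^sup>2 + 2 / (R * real N)" .
    qed (use R in auto)
    also have "(2 / R\<^sup>2 + 2 / (R * real N)) * R * (2 * pi - pi) = 2 * pi / R + 2 * pi / real N"
      using R by (simp add: power2_eq_square field_simps)
    finally have bound_low: "norm (contour_integral ?low (\<lambda>w. S w * E w * k w)) \<le> 2 * pi / R + 2 * pi / real N" .

    have "norm (2 * of_real pi * \<i> * S 0) \<le> (2 * pi / R + B / ln (real N)) + (2 * pi / R + 2 * pi / real N)"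
      unfolding eq using bound_up bound_H bound_low
      by (smt (verit) norm_triangle_ineq norm_triangle_ineq2)
    moreover have "S 0 = of_real (\<Sum>n=1..N. real_of_int (moebius_mu n) / real n)"
      unfolding S_def moebius_partial_def of_real_sum
      by (intro sum.cong) (auto simp: powr_minus field_simps)
    ultimately show "2 * pi * \<bar>\<Sum>n=1..N. real_of_int (moebius_mu n) / real n\<bar>
        \<le> 4 * pi / R + 2 * pi / real N + B / ln (real N)"
      by (simp add: norm_mult del: of_real_sum)
  qed
qed

lemma sum_moebius_mu_over_n_tendsto_0:
  "(\<lambda>N. \<Sum>n=1..N. real_of_int (moebius_mu n) / real n) \<longlonglongrightarrow> 0"
proof (rule LIMSEQ_I)
  fix e :: real assume e: "e > 0"
  \<comment> \<open>Makes \<open>4 * pi / R\<close> equal to \<open>pi * e\<close>, half of the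
    \<open>2 * pi * e\<close> available; the other two error terms vanish in the limit.\<close>
  define R where "R = 4 / e"
  have R: "R > 0" using e by (simp add: R_def)
  obtain B where B: "\<And>N. N \<ge> 2 \<Longrightarrow>
    2 * pi * \<bar>\<Sum>n=1..N. real_of_int (moebius_mu n) / real n\<bar> \<le> 4 * pi / R + 2 * pi / real N + B / ln (real N)"
    using newman_moebius_bound[OF R] by blast
  have "(\<lambda>N. 4 * pi / R + 2 * pi / real N + B / ln (real N)) \<longlonglongrightarrow> 4 * pi / R + 0 + 0"
    by (intro tendsto_add tendsto_const real_tendsto_divide_at_top[OF tendsto_const]
        filterlim_real_sequentially filterlim_compose[OF ln_at_top])
  moreover have "4 * pi / R + 0 + 0 < 2 * pi * e"
    using e by (simp add: R_def)
  ultimately have "\<forall>\<^sub>F N in sequentially. 4 * pi / R + 2 * pi / real N + B / ln (real N) < 2 * pi * e"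
    by (rule order_tendstoD)
  then have "\<forall>\<^sub>F N in sequentially. norm ((\<Sum>n=1..N. real_of_int (moebius_mu n) / real n) - 0) < e"
    using eventually_ge_at_top[of 2]
  proof eventually_elim
    case (elim N)
    then have "2 * pi * \<bar>\<Sum>n=1..N. real_of_int (moebius_mu n) / real n\<bar> < 2 * pi * e"
      by (intro le_less_trans[OF B])
    then show ?case by simp
  qed
  then show "\<exists>no. \<forall>N\<ge>no. norm ((\<Sum>n=1..N. real_of_int (moebius_mu n) / real n) - 0) < e"
    by (simp add: eventually_sequentially)
qed

section \<open>Mean values of arithmetic functions\<close>

definition nat_mean :: "(nat \<Rightarrow> real) \<Rightarrow> real \<Rightarrow> bool" where
  "nat_mean f c \<longleftrightarrow> (\<lambda>N. (\<Sum>n=1..N. f n) / real N) \<longlonglongrightarrow> c"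

text \<open>A linear bound valid for every \<open>N\<close> can be evaluated at
  \<open>N div q\<close> without separating small arguments, which suits the recursions below better
  than an eventual statement.\<close>

lemma div_real_tendsto_0_iff:
  fixes E :: "nat \<Rightarrow> real"
  shows "(\<lambda>N. E N / real N) \<longlonglongrightarrow> 0 \<longleftrightarrow> (\<forall>e>0. \<exists>C. \<forall>N. \<bar>E N\<bar> \<le> e * real N + C)"
proof
  assume lim: "(\<lambda>N. E N / real N) \<longlonglongrightarrow> 0"
  show "\<forall>e>0. \<exists>C. \<forall>N. \<bar>E N\<bar> \<le> e * real N + C"
  proof (intro allI impI)
    fix e :: real assume e: "e > 0"
    then obtain N0 where N0: "\<And>N. N \<ge> N0 \<Longrightarrow> \<bar>E N / real N\<bar> < e"
      using LIMSEQ_D[OF lim e] by auto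
    define C where "C = (\<Sum>n\<le>N0. \<bar>E n\<bar>)"
    have "\<bar>E N\<bar> \<le> e * real N + C" for N
    proof (cases "N \<le> N0")
      case True
      then have "\<bar>E N\<bar> \<le> C"
        unfolding C_def by (intro member_le_sum) auto
      then show ?thesis using e by (smt (verit) mult_nonneg_nonneg of_nat_0_le_iff)
    next
      case False
      then have "\<bar>E N\<bar> \<le> e * real N"
        using N0[of N] by (simp add: abs_divide field_simps)
      moreover have "C \<ge> 0" unfolding C_def by (intro sum_nonneg) auto
      ultimately show ?thesis by simp
    qed
    then show "\<exists>C. \<forall>N. \<bar>E N\<bar> \<le> e * real N + C" by blast
  qed
next
  assume H: "\<forall>e>0. \<exists>C. \<forall>N. \<bar>E N\<bar> \<le> e * real N + C"
  show "(\<lambda>N. E N / real N) \<longlonglongrightarrow> 0"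
  proof (rule LIMSEQ_I)
    fix e :: real assume e: "e > 0"
    then obtain C where C: "\<And>N. \<bar>E N\<bar> \<le> (e / 2) * real N + C"
      using H[rule_format, of "e / 2"] by auto
    obtain N0 :: nat where N0: "real N0 > 2 * C / e"
      using reals_Archimedean2 by blast
    have "norm (E N / real N - 0) < e" if N: "N \<ge> Suc N0" for N
    proof -
      have "2 * C / e < real N" using N0 N by linarith
      then have "2 * C < e * real N" using e by (simp add: field_simps)
      then have "\<bar>E N\<bar> < e * real N" using C[of N] by simp
      then show ?thesis using N by (simp add: abs_divide field_simps)
    qed
    then show "\<exists>no. \<forall>N\<ge>no. norm (E N / real N - 0) < e" by blast
  qed
qed

lemma nat_mean_iff_error:
  "nat_mean f c \<longleftrightarrow> (\<lambda>N. ((\<Sum>n=1..N. f n) - c * real N) / real N) \<longlonglongrightarrow> 0"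
proof -
  have "\<forall>\<^sub>F N in sequentially. ((\<Sum>n=1..N. f n) - c * real N) / real N = (\<Sum>n=1..N. f n) / real N - c"
    using eventually_gt_at_top[of 0] by eventually_elim (simp add: field_simps)
  then have "(\<lambda>N. ((\<Sum>n=1..N. f n) - c * real N) / real N) \<longlonglongrightarrow> 0
      \<longleftrightarrow> (\<lambda>N. (\<Sum>n=1..N. f n) / real N - c) \<longlonglongrightarrow> 0"
    by (rule tendsto_cong)
  then show ?thesis
    unfolding nat_mean_def by (simp add: LIM_zero_iff)
qed

text \<open>By Abel summation the sum of mu up to \<open>N\<close> is \<open>N * s N\<close> minus
  the sum of the \<open>s n\<close> below \<open>N\<close>. As \<open>s\<close> tends to 0, both are
  of order less than \<open>N\<close>.\<close>

lemma nat_mean_moebius_mu: "nat_mean (\<lambda>n. real_of_int (moebius_mu n)) 0"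
proof -
  define s where "s = (\<lambda>N. \<Sum>n=1..N. real_of_int (moebius_mu n) / real n)"
  have s: "s \<longlonglongrightarrow> 0"
    unfolding s_def by (rule sum_moebius_mu_over_n_tendsto_0)
  have abel: "(\<Sum>n=1..N. real_of_int (moebius_mu n)) = real N * s N - (\<Sum>n<N. s n)" for N
  proof (induction N)
    case (Suc N)
    have "s (Suc N) = s N + real_of_int (moebius_mu (Suc N)) / real (Suc N)"
      by (simp add: s_def)
    then have "real (Suc N) * s (Suc N) = real (Suc N) * s N + real_of_int (moebius_mu (Suc N))"
      by (simp add: distrib_left del: of_nat_Suc)
    then show ?case
      using Suc.IH by (simp add: algebra_simps)
  qed (simp add: s_def)
  have "(\<lambda>N. (\<Sum>n=1..N. real_of_int (moebius_mu n)) / real N) \<longlonglongrightarrow> 0"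
    unfolding div_real_tendsto_0_iff
  proof (intro allI impI)
    fix e :: real assume "e > 0"
    then have e: "e / 2 > 0" by simp
    obtain N0 where N0: "\<And>n. n \<ge> N0 \<Longrightarrow> \<bar>s n\<bar> < e / 2"
      using LIMSEQ_D[OF s e] by auto
    define C where "C = (\<Sum>n<N0. \<bar>s n\<bar>)"
    define C' where "C' = (\<Sum>n<N0. real n * \<bar>s n\<bar>)"
    have C0: "C \<ge> 0" "C' \<ge> 0" unfolding C_def C'_def by (auto intro: sum_nonneg)
    have "\<bar>\<Sum>n=1..N. real_of_int (moebius_mu n)\<bar> \<le> e * real N + (C + C')" for N
    proof -
      have "(\<Sum>n<N. \<bar>s n\<bar>) \<le> (\<Sum>n<N. e / 2 + (if n < N0 then \<bar>s n\<bar> else 0))"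
        using N0 e by (intro sum_mono) (auto simp: not_less intro: less_imp_le)
      also have "\<dots> = e / 2 * real N + (\<Sum>n\<in>{n\<in>{..<N}. n < N0}. \<bar>s n\<bar>)"
        by (subst sum.inter_filter) (simp_all add: sum.distrib mult.commute)
      also have "(\<Sum>n\<in>{n\<in>{..<N}. n < N0}. \<bar>s n\<bar>) \<le> C"
        unfolding C_def by (intro sum_mono2) auto
      finally have 1: "(\<Sum>n<N. \<bar>s n\<bar>) \<le> e / 2 * real N + C" by simp
      have 2: "real N * \<bar>s N\<bar> \<le> e / 2 * real N + C'"
      proof (cases "N < N0")
        case True
        then have "real N * \<bar>s N\<bar> \<le> C'"
          unfolding C'_def by (intro member_le_sum) auto
        then show ?thesis using e by (smt (verit) mult_nonneg_nonneg of_nat_0_le_iff)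
      next
        case False
        then have "real N * \<bar>s N\<bar> \<le> real N * (e / 2)"
          using N0[of N] by (intro mult_left_mono) auto
        then show ?thesis using C0 by (simp add: mult.commute)
      qed
      have "\<bar>\<Sum>n=1..N. real_of_int (moebius_mu n)\<bar> \<le> \<bar>real N * s N\<bar> + \<bar>\<Sum>n<N. s n\<bar>"
        unfolding abel by linarith
      also have "\<dots> \<le> real N * \<bar>s N\<bar> + (\<Sum>n<N. \<bar>s n\<bar>)"
        by (intro add_mono sum_abs) (simp add: abs_mult)
      also have "\<dots> \<le> e * real N + (C + C')"
        using 1 2 by simp
      finally show ?thesis .
    qed
    then show "\<exists>C. \<forall>N. \<bar>\<Sum>n=1..N. real_of_int (moebius_mu n)\<bar> \<le> e * real N + C" by blast
  qed
  then show ?thesis by (simp add: nat_mean_def)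
qed

section \<open>Counting multiples and the density of squarefree numbers\<close>

lemma real_div_minus_nat_div_le: "real N / real q - real (N div q) \<le> 1"
  using real_of_int_div3[of "int N" "int q"] by (metis of_int_of_nat_eq zdiv_int)

lemma sum_multiples:
  fixes f :: "nat \<Rightarrow> 'a :: comm_monoid_add"
  assumes "q > 0"
  shows "(\<Sum>n\<in>{n\<in>{1..N}. q dvd n}. f n) = (\<Sum>m=1..N div q. f (q * m))"
  by (rule sum.reindex_bij_witness[where i = "\<lambda>m. q * m" and j = "\<lambda>n. n div q"])
    (use assms in \<open>auto simp: less_eq_div_iff_mult_less_eq mult.commute elim!: dvdE intro: Nat.gr0I\<close>)

lemma card_multiples:
  assumes "q > 0"
  shows "card {n\<in>{1..N}. q dvd n} = N div q"
  using sum_multiples[OF assms, of "\<lambda>_. 1::nat" N] by simp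

lemma sum_moebius_mu_square_divisors:
  assumes "n > 0"
  shows "(\<Sum>d | d\<^sup>2 dvd n. moebius_mu d) = (moebius_mu n)\<^sup>2"
proof -
  have "{d. d\<^sup>2 dvd n} = {d. d dvd square_part n}"
    by (simp add: dvd_square_part_iff)
  moreover have "square_part n > 0"
    using assms by (intro Nat.gr0I) simp
  ultimately have "(\<Sum>d | d\<^sup>2 dvd n. moebius_mu d) = (if square_part n = 1 then 1 else 0)"
    using sum_moebius_mu_divisors[of "square_part n"] by simp
  also have "square_part n = 1 \<longleftrightarrow> squarefree n"
  proof
    assume 1: "square_part n = 1"
    show "squarefree n"
    proof (rule squarefreeI)
      fix x assume "x\<^sup>2 dvd n"
      then have "x dvd square_part n" by (simp add: dvd_square_part_iff)
      then show "x dvd 1" using 1 by simp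
    qed
  next
    assume "squarefree n"
    then show "square_part n = 1"
      using squarefreeD[of n "square_part n"] by simp
  qed
  finally show ?thesis
    using moebius_mu_cases[of n] moebius_mu_eq_0_iff[of n] by auto
qed

lemma suminf_moebius_mu_over_square:
  "(\<Sum>n. real_of_int (moebius_mu n) / (real n)\<^sup>2) = 6 / pi\<^sup>2"
proof -
  have powr: "of_nat n powr (- 2) = (of_real (1 / (real n)\<^sup>2) :: complex)" for n
    by (cases "n = 0") (simp_all add: powr_minus divide_inverse)
  have norm_mu: "norm (of_int (moebius_mu n) :: complex) \<le> 1" for n
    using moebius_mu_cases[of n] by auto
  define D where "D = (\<Sum>\<^sub>\<infinity>n. of_int (moebius_mu n) * of_nat n powr (- 2) :: complex)"
  have "(\<lambda>n. of_int (moebius_mu n) * of_nat n powr (- 2)) sums D"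
    unfolding D_def using norm_mu by (intro has_sum_imp_sums has_sum_infsum summable_on_bounded_dirichlet) auto
  moreover have "of_int (moebius_mu n) * of_nat n powr (- 2) = complex_of_real (real_of_int (moebius_mu n) / (real n)\<^sup>2)" for n
    by (simp add: powr)
  ultimately have D: "(\<lambda>n. complex_of_real (real_of_int (moebius_mu n) / (real n)\<^sup>2)) sums D"
    by simp
  have "(\<lambda>n. 1 / (real (Suc n))\<^sup>2) sums (pi\<^sup>2 / 6)"
    using inverse_squares_sums by (simp add: add.commute)
  then have "(\<lambda>n. 1 / (real n)\<^sup>2) sums (pi\<^sup>2 / 6)"
    by (subst (asm) sums_Suc_iff) simp
  then have "(\<lambda>n. complex_of_real (1 / (real n)\<^sup>2)) sums of_real (pi\<^sup>2 / 6)"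
    by (rule sums_of_real)
  moreover have "(\<lambda>n. of_nat n powr (- 2) :: complex) sums zeta 2"
    unfolding zeta_def by (intro has_sum_imp_sums has_sum_infsum summable_on_dirichlet) auto
  then have "(\<lambda>n. complex_of_real (1 / (real n)\<^sup>2)) sums zeta 2"
    by (simp add: powr)
  ultimately have zeta2: "zeta 2 = of_real (pi\<^sup>2 / 6)"
    using sums_unique2 by blast
  have "D * of_real (pi\<^sup>2 / 6) = 1"
    using moebius_dirichlet_mult_zeta[of 2] unfolding D_def zeta2 [symmetric] by simp
  then have "D = of_real (6 / pi\<^sup>2)"
    by (simp add: field_simps)
  then have "(\<lambda>n. real_of_int (moebius_mu n) / (real n)\<^sup>2) sums (6 / pi\<^sup>2)"
    using D sums_of_real_iff by metis
  then show ?thesis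
    by (simp add: sums_iff)
qed

text \<open>Expanding the square of mu over square divisors and exchanging sums gives
  \<open>moebius_mu d\<close> weighted by the number of multiples of the square of \<open>d\<close>.
  Tannery's theorem, with an inverse-square majorant, takes the limit termwise and leaves
  1/zeta(2).\<close>

lemma nat_mean_moebius_mu_squared: "nat_mean (\<lambda>n. (real_of_int (moebius_mu n))\<^sup>2) (6 / pi\<^sup>2)"
proof -
  define a where "a = (\<lambda>d N. real_of_int (moebius_mu d) * real (N div d\<^sup>2) / real N)"
  have mu0: "moebius_mu 0 = 0"
    by (simp add: moebius_mu_eq_0_iff)
  have mu_le: "\<bar>real_of_int (moebius_mu d)\<bar> \<le> 1" for d
    using moebius_mu_cases[of d] by auto
  have bound: "\<bar>a d N\<bar> \<le> 1 / (real d)\<^sup>2" for d N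
  proof (cases "d = 0 \<or> N = 0")
    case True
    then show ?thesis by (auto simp: a_def mu0)
  next
    case False
    have "real (N div d\<^sup>2) \<le> real N / (real d)\<^sup>2"
      using of_nat_div_le_of_nat[of N "d\<^sup>2"] by simp
    then have "\<bar>real_of_int (moebius_mu d)\<bar> * real (N div d\<^sup>2) \<le> 1 * (real N / (real d)\<^sup>2)"
      using mu_le by (intro mult_mono) auto
    then show ?thesis
      using False by (simp add: a_def abs_mult abs_divide field_simps)
  qed
  have lim: "(\<lambda>N. a d N) \<longlonglongrightarrow> real_of_int (moebius_mu d) / (real d)\<^sup>2" for d
  proof (cases "d = 0")
    case True
    then show ?thesis by (simp add: a_def mu0)
  next
    case False
    have "(\<lambda>N. real (N div d\<^sup>2) / real N) \<longlonglongrightarrow> 1 / (real d)\<^sup>2"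
    proof (rule LIM_zero_cancel, rule Lim_null_comparison)
      show "\<forall>\<^sub>F N in sequentially. norm (real (N div d\<^sup>2) / real N - 1 / (real d)\<^sup>2) \<le> 1 / real N"
        using eventually_gt_at_top[of 0]
      proof eventually_elim
        case (elim N)
        have "real (N div d\<^sup>2) \<le> real N / (real d)\<^sup>2" "real N / (real d)\<^sup>2 - real (N div d\<^sup>2) \<le> 1"
          using of_nat_div_le_of_nat[of N "d\<^sup>2"] real_div_minus_nat_div_le[of N "d\<^sup>2"] by simp_all
        then have "\<bar>real (N div d\<^sup>2) - real N / (real d)\<^sup>2\<bar> \<le> 1" by simp
        then have "\<bar>real (N div d\<^sup>2) - real N / (real d)\<^sup>2\<bar> / real N \<le> 1 / real N"
          by (intro divide_right_mono) auto
        moreover have "real (N div d\<^sup>2) / real N - 1 / (real d)\<^sup>2 = (real (N div d\<^sup>2) - real N / (real d)\<^sup>2) / real N"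
          using elim by (simp add: diff_divide_distrib)
        ultimately show ?case by (simp add: abs_divide)
      qed
      show "(\<lambda>N. 1 / real N) \<longlonglongrightarrow> 0"
        by (rule lim_1_over_n)
    qed
    then have "(\<lambda>N. real_of_int (moebius_mu d) * (real (N div d\<^sup>2) / real N))
        \<longlonglongrightarrow> real_of_int (moebius_mu d) * (1 / (real d)\<^sup>2)"
      by (rule tendsto_mult_left)
    then show ?thesis by (simp add: a_def)
  qed
  have "summable (\<lambda>d. 1 / (real d)\<^sup>2)"
    using inverse_power_summable[of 2, where 'a = real] by (simp add: inverse_eq_divide)
  then have "(\<lambda>N. \<Sum>d. a d N) \<longlonglongrightarrow> (\<Sum>d. real_of_int (moebius_mu d) / (real d)\<^sup>2)"
    using tannerys_theorem[where a = a and F = sequentially and M = "\<lambda>d. 1 / (real d)\<^sup>2", OF lim]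
      bound by (auto simp: always_eventually)
  moreover have "(\<Sum>d. a d N) = (\<Sum>n=1..N. (real_of_int (moebius_mu n))\<^sup>2) / real N" for N
  proof -
    have "a d N = 0" if "d \<notin> {1..N}" for d
    proof (cases "d = 0")
      case False
      then have "N < d" using that by auto
      moreover have "d \<le> d\<^sup>2" by (simp add: power2_nat_le_imp_le self_le_power)
      ultimately have "N div d\<^sup>2 = 0" by (intro div_less) linarith
      then show ?thesis by (simp add: a_def)
    qed (simp add: a_def mu0)
    then have "(\<Sum>d. a d N) = (\<Sum>d\<in>{1..N}. a d N)"
      by (intro suminf_finite) auto
    also have "\<dots> = (\<Sum>d\<in>{1..N}. \<Sum>n\<in>{n\<in>{1..N}. d\<^sup>2 dvd n}. real_of_int (moebius_mu d)) / real N"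
    proof -
      have "(\<Sum>n\<in>{n\<in>{1..N}. d\<^sup>2 dvd n}. real_of_int (moebius_mu d)) = real_of_int (moebius_mu d) * real (N div d\<^sup>2)"
        if "d \<in> {1..N}" for d
      proof -
        have "card {n\<in>{1..N}. d\<^sup>2 dvd n} = N div d\<^sup>2"
          using that by (intro card_multiples) simp
        then show ?thesis
          unfolding sum_constant by (simp only: mult.commute)
      qed
      then have "(\<Sum>d\<in>{1..N}. \<Sum>n\<in>{n\<in>{1..N}. d\<^sup>2 dvd n}. real_of_int (moebius_mu d))
        = (\<Sum>d\<in>{1..N}. real_of_int (moebius_mu d) * real (N div d\<^sup>2))"
        by (rule sum.cong [OF refl])
      then show ?thesis
        unfolding a_def sum_divide_distrib [symmetric] by (simp only:)
    qed
    also have "(\<Sum>d\<in>{1..N}. \<Sum>n\<in>{n\<in>{1..N}. d\<^sup>2 dvd n}. real_of_int (moebius_mu d))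
      = (\<Sum>n\<in>{1..N}. \<Sum>d\<in>{d\<in>{1..N}. d\<^sup>2 dvd n}. real_of_int (moebius_mu d))"
      by (rule sum.swap_restrict) auto
    also have "\<dots> = (\<Sum>n=1..N. (real_of_int (moebius_mu n))\<^sup>2)"
    proof (rule sum.cong [OF refl])
      fix n assume n: "n \<in> {1..N}"
      have "{d\<in>{1..N}. d\<^sup>2 dvd n} = {d. d\<^sup>2 dvd n}"
      proof -
        have "1 \<le> d \<and> d \<le> N" if "d\<^sup>2 dvd n" for d
        proof -
          have "d\<^sup>2 \<le> n" using that n by (intro dvd_imp_le) auto
          moreover have "d \<le> d\<^sup>2" by (cases "d = 0") (auto simp: power2_eq_square)
          moreover have "d \<noteq> 0" using that n by (intro notI) auto
          ultimately show ?thesis using n by auto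
        qed
        then show ?thesis by auto
      qed
      then have "(\<Sum>d\<in>{d\<in>{1..N}. d\<^sup>2 dvd n}. real_of_int (moebius_mu d))
        = real_of_int (\<Sum>d | d\<^sup>2 dvd n. moebius_mu d)"
        by simp
      also have "\<dots> = (real_of_int (moebius_mu n))\<^sup>2"
        using n by (subst sum_moebius_mu_square_divisors) auto
      finally show "(\<Sum>d\<in>{d\<in>{1..N}. d\<^sup>2 dvd n}. real_of_int (moebius_mu d)) = (real_of_int (moebius_mu n))\<^sup>2" .
    qed
    finally show ?thesis .
  qed
  ultimately show ?thesis
    by (simp add: nat_mean_def suminf_moebius_mu_over_square)
qed

section \<open>Removing finitely many primes from a mean value\<close>

text \<open>The coefficient of \<open>f (N div q)\<close> is 1, so the gain comes from the argument:
  it is at most \<open>N / 2\<close>, and a bound with slope \<open>e\<close> returns with slope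
  \<open>e / 2\<close>. The a priori linear bound starts the induction.\<close>

lemma sublinear_of_contraction:
  fixes f h :: "nat \<Rightarrow> real"
  assumes q: "q \<ge> 2"
    and h: "(\<lambda>N. h N / real N) \<longlonglongrightarrow> 0"
    and rec: "\<And>N. \<bar>f N\<bar> \<le> \<bar>h N\<bar> + \<bar>f (N div q)\<bar> + c"
    and lin: "\<And>N. \<bar>f N\<bar> \<le> K * real N"
  shows "(\<lambda>N. f N / real N) \<longlonglongrightarrow> 0"
  unfolding div_real_tendsto_0_iff
proof (intro allI impI)
  fix e :: real assume e: "e > 0"
  \<comment> \<open>Budget for slope \<open>e\<close>: one half for the recursive term, one quarter
    for \<open>h\<close>, one quarter for the constants \<open>C + c\<close> once \<open>N\<close>
    is large.\<close>
  then obtain C where C: "\<And>N. \<bar>h N\<bar> \<le> (e / 4) * real N + C"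
    using h[unfolded div_real_tendsto_0_iff, rule_format, of "e / 4"] by auto
  have K: "K \<ge> 0" using lin[of 1] by simp
  \<comment> \<open>The linear bound evaluated at the threshold below which the constants are not
    yet absorbed.\<close>
  define C' where "C' = K * (4 * \<bar>C + c\<bar> / e)"
  have "\<bar>f N\<bar> \<le> e * real N + C'" for N
  proof (induction N rule: less_induct)
    case (less N)
    show ?case
    proof (cases "real N \<le> 4 * \<bar>C + c\<bar> / e")
      case True
      then have "K * real N \<le> C'"
        unfolding C'_def using K by (intro mult_left_mono)
      then show ?thesis
        using lin[of N] e by (smt (verit) mult_nonneg_nonneg of_nat_0_le_iff)
    next
      case False
      then have N: "\<bar>C + c\<bar> < e / 4 * real N" using e by (simp add: field_simps)
      have "real N > 0"
        using False e by (smt (verit) divide_nonneg_pos mult_nonneg_nonneg abs_ge_zero)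
      then have "N > 0" by simp
      then have "N div q < N" using q by simp
      then have IH: "\<bar>f (N div q)\<bar> \<le> e * real (N div q) + C'" by (rule less.IH)
      have "N div q \<le> N div 2" using q by (intro div_le_mono2) auto
      then have "real (N div q) \<le> real N / 2" by linarith
      then have "e * real (N div q) \<le> e * (real N / 2)" using e by (intro mult_left_mono) auto
      then have "e * real (N div q) \<le> e * real N / 2" by simp
      moreover have "\<bar>h N\<bar> \<le> e * real N / 4 + C" using C[of N] by simp
      moreover have "\<bar>C + c\<bar> < e * real N / 4" using N by simp
      ultimately show ?thesis
        using rec[of N] IH by linarith
    qed
  qed
  then show "\<exists>C. \<forall>N. \<bar>f N\<bar> \<le> e * real N + C" by blast
qed

text \<open>Splitting off the multiples of \<open>q\<close> gives
  \<open>S N = S' N + a * S' (N div q)\<close>. If \<open>S'\<close> has mean \<open>c'\<close>,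
  this forces \<open>c = c' * (1 + a / q)\<close>; that the mean exists follows by applying the
  contraction to the error.\<close>

lemma nat_mean_sieve_prime:
  fixes g g' :: "nat \<Rightarrow> real"
  assumes q: "q \<ge> 2" and a: "\<bar>a\<bar> \<le> 1"
    and bounded: "\<And>n. \<bar>g' n\<bar> \<le> 1"
    and off: "\<And>n. \<not> q dvd n \<Longrightarrow> g' n = g n" and on: "\<And>n. q dvd n \<Longrightarrow> g' n = 0"
    and mult: "\<And>m. g (q * m) = a * g' m"
    and mean: "nat_mean g c"
  shows "nat_mean g' (c / (1 + a / real q))"
proof -
  define c' where "c' = c / (1 + a / real q)"
  define S where "S = (\<lambda>N. \<Sum>n=1..N. g n)"
  define S' where "S' = (\<lambda>N. \<Sum>n=1..N. g' n)"
  have "\<bar>a / real q\<bar> \<le> 1 / 2"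
    using q a by (simp add: abs_divide field_simps)
  then have "1 + a / real q \<noteq> 0" by linarith
  then have c: "c = c' * (1 + a / real q)" by (simp add: c'_def)
  have rec: "S N = S' N + a * S' (N div q)" for N
  proof -
    have "S N = (\<Sum>n\<in>{1..N}. g' n + (if q dvd n then g n else 0))"
      unfolding S_def using off on by (intro sum.cong) auto
    also have "\<dots> = S' N + (\<Sum>n\<in>{n\<in>{1..N}. q dvd n}. g n)"
      by (subst sum.inter_filter) (simp_all add: sum.distrib S'_def)
    also have "(\<Sum>n\<in>{n\<in>{1..N}. q dvd n}. g n) = (\<Sum>m=1..N div q. g (q * m))"
      using q by (intro sum_multiples) auto
    also have "\<dots> = a * S' (N div q)"
      by (simp add: mult S'_def sum_distrib_left)
    finally show ?thesis .
  qed
  have "(\<lambda>N. (S' N - c' * real N) / real N) \<longlonglongrightarrow> 0"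
  proof (rule sublinear_of_contraction[OF q])
    show "(\<lambda>N. (S N - c * real N) / real N) \<longlonglongrightarrow> 0"
      using mean by (simp add: nat_mean_iff_error S_def)
    fix N
    have "\<bar>S' N\<bar> \<le> (\<Sum>n=1..N. 1)"
      unfolding S'_def using bounded by (intro order_trans[OF sum_abs] sum_mono)
    then have "\<bar>S' N\<bar> \<le> real N" by simp
    then show "\<bar>S' N - c' * real N\<bar> \<le> (1 + \<bar>c'\<bar>) * real N"
      using abs_triangle_ineq4[of "S' N" "c' * real N"] by (simp add: distrib_right abs_mult)
    define \<delta> where "\<delta> = real N / real q - real (N div q)"
    have \<delta>: "0 \<le> \<delta>" "\<delta> \<le> 1"
      using of_nat_div_le_of_nat[of N q] real_div_minus_nat_div_le[of N q] by (simp_all add: \<delta>_def)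
    have "S' N - c' * real N
        = (S N - c * real N) - a * (S' (N div q) - c' * real (N div q)) + a * c' * \<delta>"
      unfolding \<delta>_def rec c by (simp add: algebra_simps)
    also have "\<bar>\<dots>\<bar> \<le> \<bar>S N - c * real N\<bar> + \<bar>a * (S' (N div q) - c' * real (N div q))\<bar> + \<bar>a * c' * \<delta>\<bar>"
      by linarith
    also have "\<dots> \<le> \<bar>S N - c * real N\<bar> + \<bar>S' (N div q) - c' * real (N div q)\<bar> + \<bar>c'\<bar>"
    proof (intro add_mono order_refl)
      show "\<bar>a * (S' (N div q) - c' * real (N div q))\<bar> \<le> \<bar>S' (N div q) - c' * real (N div q)\<bar>"
        using a by (simp add: abs_mult mult_left_le_one_le)
      have "\<bar>a\<bar> * \<bar>c'\<bar> * \<bar>\<delta>\<bar> \<le> 1 * \<bar>c'\<bar> * 1"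
        using a \<delta> by (intro mult_mono) auto
      then show "\<bar>a * c' * \<delta>\<bar> \<le> \<bar>c'\<bar>" by (simp add: abs_mult)
    qed
    finally show "\<bar>S' N - c' * real N\<bar> \<le> \<bar>S N - c * real N\<bar> + \<bar>S' (N div q) - c' * real (N div q)\<bar> + \<bar>c'\<bar>" .
  qed
  then show ?thesis
    unfolding nat_mean_iff_error by (simp add: S'_def c'_def)
qed

lemma nat_mean_sieve:
  fixes g :: "nat \<Rightarrow> real"
  assumes "finite P" "\<And>p. p \<in> P \<Longrightarrow> prime p"
    and a: "\<bar>a\<bar> \<le> 1" and bounded: "\<And>n. \<bar>g n\<bar> \<le> 1"
    and mult: "\<And>p m. prime p \<Longrightarrow> g (p * m) = (if p dvd m then 0 else a * g m)"
    and mean: "nat_mean g c"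
  shows "nat_mean (\<lambda>n. if \<forall>p\<in>P. \<not> p dvd n then g n else 0) (c / (\<Prod>p\<in>P. 1 + a / real p))"
  using assms(1,2)
proof (induction P rule: finite_induct)
  case empty
  then show ?case using mean by simp
next
  case (insert q P)
  let ?g = "\<lambda>P n. if \<forall>p\<in>P. \<not> p dvd n then g n else 0"
  have q: "prime q" and P: "\<And>p. p \<in> P \<Longrightarrow> prime p" using insert.prems by auto
  have ndvd: "\<not> p dvd q" if "p \<in> P" for p
    using that insert.hyps q P primes_dvd_imp_eq[of p q] by auto
  have "nat_mean (?g (insert q P)) (c / (\<Prod>p\<in>P. 1 + a / real p) / (1 + a / real q))"
  proof (rule nat_mean_sieve_prime[of q a])
    show "q \<ge> 2" using q prime_ge_2_nat by blast
    show "nat_mean (?g P) (c / (\<Prod>p\<in>P. 1 + a / real p))"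
      using insert.IH P by blast
    fix m
    have "(\<forall>p\<in>P. \<not> p dvd q * m) \<longleftrightarrow> (\<forall>p\<in>P. \<not> p dvd m)"
      using ndvd P by (auto simp: prime_dvd_mult_iff)
    then show "?g P (q * m) = a * ?g (insert q P) m"
      using mult[OF q, of m] by auto
  qed (use a bounded in auto)
  then show ?case
    using insert.hyps by (simp add: mult.commute)
qed

lemma nat_mean_dilate:
  fixes g :: "nat \<Rightarrow> real"
  assumes "L > 0" "nat_mean g c"
  shows "nat_mean (\<lambda>n. if L dvd n then g (n div L) else 0) (c / real L)"
proof -
  define S where "S = (\<lambda>N. \<Sum>n=1..N. g n)"
  have "(\<Sum>n=1..N. if L dvd n then g (n div L) else 0) = S (N div L)" for N
  proof -
    have "(\<Sum>n=1..N. if L dvd n then g (n div L) else 0) = (\<Sum>n\<in>{n\<in>{1..N}. L dvd n}. g (n div L))"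
      by (rule sum.inter_filter [symmetric]) simp
    also have "\<dots> = S (N div L)"
      using assms(1) by (subst sum_multiples) (auto simp: S_def)
    finally show ?thesis .
  qed
  moreover have "(\<lambda>N. (S (N div L) - c / real L * real N) / real N) \<longlonglongrightarrow> 0"
    unfolding div_real_tendsto_0_iff
  proof (intro allI impI)
    fix e :: real assume e: "e > 0"
    then obtain C where C: "\<And>N. \<bar>S N - c * real N\<bar> \<le> e * real N + C"
      using assms(2) unfolding nat_mean_iff_error div_real_tendsto_0_iff S_def by meson
    have "\<bar>S (N div L) - c / real L * real N\<bar> \<le> e * real N + (C + \<bar>c\<bar>)" for N
    proof -
      define \<delta> where "\<delta> = real N / real L - real (N div L)"
      have \<delta>: "\<bar>\<delta>\<bar> \<le> 1"
        using of_nat_div_le_of_nat[of N L, where 'a = real] real_div_minus_nat_div_le[of N L] by (simp add: \<delta>_def)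
      have "S (N div L) - c / real L * real N = (S (N div L) - c * real (N div L)) - c * \<delta>"
        by (simp add: \<delta>_def algebra_simps)
      also have "\<bar>\<dots>\<bar> \<le> \<bar>S (N div L) - c * real (N div L)\<bar> + \<bar>c\<bar> * \<bar>\<delta>\<bar>"
        by (simp add: abs_mult [symmetric])
      also have "\<dots> \<le> (e * real (N div L) + C) + \<bar>c\<bar> * 1"
        using C \<delta> by (intro add_mono mult_left_mono) auto
      also have "e * real (N div L) \<le> e * real N"
        using e by (intro mult_left_mono) (auto simp: div_le_dividend)
      finally show ?thesis by simp
    qed
    then show "\<exists>C. \<forall>N. \<bar>S (N div L) - c / real L * real N\<bar> \<le> e * real N + C" by blast
  qed
  ultimately show ?thesis
    unfolding nat_mean_iff_error by simp
qed

lemma nat_mean_sum: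
  assumes "\<And>i. i \<in> I \<Longrightarrow> nat_mean (f i) (c i)"
  shows "nat_mean (\<lambda>n. \<Sum>i\<in>I. f i n) (\<Sum>i\<in>I. c i)"
proof -
  have "(\<lambda>N. \<Sum>i\<in>I. (\<Sum>n=1..N. f i n) / real N) \<longlonglongrightarrow> (\<Sum>i\<in>I. c i)"
    using assms unfolding nat_mean_def by (intro tendsto_sum) auto
  then show ?thesis
    unfolding nat_mean_def by (subst sum.swap) (simp add: sum_divide_distrib)
qed

lemma nat_mean_lincomb:
  assumes "nat_mean f c" "nat_mean g d"
  shows "nat_mean (\<lambda>n. x * f n + y * g n) (x * c + y * d)"
proof -
  have "(\<lambda>N. x * ((\<Sum>n=1..N. f n) / real N) + y * ((\<Sum>n=1..N. g n) / real N)) \<longlonglongrightarrow> x * c + y * d"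
    using assms unfolding nat_mean_def by (intro tendsto_intros)
  then show ?thesis
    unfolding nat_mean_def by (simp add: sum.distrib sum_distrib_left add_divide_distrib)
qed

text \<open>A discrepancy at \<open>n = 1\<close> is averaged away; it is permitted because the
  product formula has the opposite sign there. Real cutoffs reduce to integers since the ratio of
  the floor of \<open>x\<close> to \<open>x\<close> tends to 1.\<close>

lemma has_mean_value_of_nat_mean:
  assumes "nat_mean f c" "\<And>n. n > 1 \<Longrightarrow> F n = complex_of_real (f n)"
  shows "has_mean_value F (complex_of_real c)"
proof -
  define S where "S = (\<lambda>N. \<Sum>n=1..N. F n)"
  define \<delta> where "\<delta> = F 1 - of_real (f 1)"
  have S: "S N = of_real (\<Sum>n=1..N. f n) + \<delta>" if "N > 0" for N
  proof -
    have "{1..N} = insert 1 {2..N}" using that by auto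
    moreover have "(\<Sum>n\<in>{2..N}. F n) = (\<Sum>n\<in>{2..N}. of_real (f n))"
      by (intro sum.cong) (auto simp: assms(2))
    ultimately show ?thesis by (simp add: S_def \<delta>_def)
  qed
  have "(\<lambda>N. complex_of_real ((\<Sum>n=1..N. f n) / real N) + \<delta> / of_nat N) \<longlonglongrightarrow> of_real c + 0"
    using assms(1) unfolding nat_mean_def
    by (intro tendsto_intros lim_const_over_n)
  moreover have "\<forall>\<^sub>F N in sequentially. complex_of_real ((\<Sum>n=1..N. f n) / real N) + \<delta> / of_nat N = S N / of_nat N"
    using eventually_gt_at_top[of 0] by eventually_elim (simp add: S add_divide_distrib)
  ultimately have lim: "(\<lambda>N. S N / of_nat N) \<longlonglongrightarrow> of_real c"
    by (simp add: tendsto_cong)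
  have "filterlim (\<lambda>x::real. nat \<lfloor>x\<rfloor>) at_top at_top"
    by (intro filterlim_compose[OF filterlim_nat_sequentially] filterlim_floor_sequentially)
  then have "((\<lambda>x::real. S (nat \<lfloor>x\<rfloor>) / of_nat (nat \<lfloor>x\<rfloor>)) \<longlongrightarrow> of_real c) at_top"
    by (rule filterlim_compose[OF lim])
  moreover have "((\<lambda>x::real. real (nat \<lfloor>x\<rfloor>) / x) \<longlongrightarrow> 1) at_top"
  proof (rule LIM_zero_cancel, rule Lim_null_comparison)
    show "\<forall>\<^sub>F x::real in at_top. norm (real (nat \<lfloor>x\<rfloor>) / x - 1) \<le> 1 / x"
      using eventually_gt_at_top[of 0]
    proof eventually_elim
      case (elim x)
      have "real (nat \<lfloor>x\<rfloor>) / x - 1 = (real (nat \<lfloor>x\<rfloor>) - x) / x"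
        using elim by (simp add: diff_divide_distrib)
      moreover have "\<bar>real (nat \<lfloor>x\<rfloor>) - x\<bar> \<le> 1"
        using elim by linarith
      ultimately show ?case
        using elim by (simp add: abs_divide divide_right_mono)
    qed
    show "((\<lambda>x::real. 1 / x) \<longlongrightarrow> 0) at_top"
      by (intro real_tendsto_divide_at_top[OF tendsto_const] filterlim_ident)
  qed
  then have "((\<lambda>x::real. complex_of_real (real (nat \<lfloor>x\<rfloor>) / x)) \<longlongrightarrow> of_real 1) at_top"
    by (rule tendsto_of_real)
  ultimately have "((\<lambda>x::real. complex_of_real (real (nat \<lfloor>x\<rfloor>) / x) * (S (nat \<lfloor>x\<rfloor>) / of_nat (nat \<lfloor>x\<rfloor>)))
      \<longlongrightarrow> of_real 1 * of_real c) at_top"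
    by (intro tendsto_mult)
  moreover have "\<forall>\<^sub>F x::real in at_top. complex_of_real (real (nat \<lfloor>x\<rfloor>) / x) * (S (nat \<lfloor>x\<rfloor>) / of_nat (nat \<lfloor>x\<rfloor>))
      = 1 / of_real x * (\<Sum>n | 1 \<le> n \<and> real n \<le> x. F n)"
    using eventually_ge_at_top[of 1]
  proof eventually_elim
    case (elim x)
    have "{n. 1 \<le> n \<and> real n \<le> x} = {1..nat \<lfloor>x\<rfloor>}"
      using elim by (auto simp: le_nat_floor) linarith
    moreover have "nat \<lfloor>x\<rfloor> \<noteq> 0" using elim by simp
    ultimately show ?case
      by (simp add: S_def)
  qed
  ultimately show ?thesis
    unfolding has_mean_value_def by (simp add: tendsto_cong)
qed

section \<open>Coefficients of cyclotomic polynomials\<close>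

text \<open>Both sides are monic of degree \<open>n\<close> and vanish at the same \<open>n\<close>
  distinct points, so their difference has more roots than its degree allows.\<close>

lemma prod_root_unity_linear_factors:
  assumes "n > 0"
  shows "(\<Prod>j\<in>{1..n}. [:- exp (2 * of_real pi * \<i> * of_nat j / of_nat n), 1:])
    = (monom 1 n - 1 :: complex poly)" (is "?P = ?Q")
proof -
  define e where "e = (\<lambda>j::nat. exp (2 * of_real pi * \<i> * of_nat j / of_nat n) :: complex)"
  have inj: "inj_on e {1..n}"
  proof (rule inj_onI)
    fix i j assume ij: "i \<in> {1..n}" "j \<in> {1..n}" "e i = e j"
    then have "i mod n = j mod n"
      using assms complex_root_unity_eq[of n i j] by (simp add: e_def)
    then show "i = j"
      using ij by (cases "i = n"; cases "j = n") auto
  qed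
  have roots: "poly ?Q (e j) = 0" for j
    using assms complex_root_unity[of n j] by (simp add: poly_monom e_def)
  have P: "?P = (\<Prod>j\<in>{1..n}. [:- e j, 1:])"
    by (simp add: e_def)
  have degP: "degree ?P = n" and leadP: "lead_coeff ?P = 1"
    unfolding P by (subst degree_prod_eq_sum_degree, auto simp: lead_coeff_prod)
  have degQ: "degree ?Q \<le> n"
    by (intro degree_diff_le) (auto simp: degree_monom_le)
  have "coeff ?Q n = 1"
    using assms by (simp add: coeff_diff)
  then have cn: "coeff (?P - ?Q) n = 0"
    using degP leadP by simp
  have deg: "degree (?P - ?Q) < n \<or> ?P - ?Q = 0"
    using cn degP degQ degree_diff_le[of ?P n ?Q] leading_coeff_0_iff
    by (metis le_neq_implies_less order_refl)
  have sub: "e ` {1..n} \<subseteq> {x. poly (?P - ?Q) x = 0}"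
  proof clarify
    fix j assume "j \<in> {1..n}"
    then have "poly ?P (e j) = 0"
      unfolding P poly_prod by (intro prod_zero) auto
    then show "poly (?P - ?Q) (e j) = 0"
      using roots by simp
  qed
  have "?P - ?Q = 0"
  proof (rule ccontr)
    assume nz: "?P - ?Q \<noteq> 0"
    have "n = card (e ` {1..n})"
      using inj by (simp add: card_image)
    also have "\<dots> \<le> card {x. poly (?P - ?Q) x = 0}"
      using nz by (intro card_mono sub poly_roots_finite)
    also have "\<dots> \<le> degree (?P - ?Q)"
      using nz by (rule card_poly_roots_bound)
    finally show False
      using deg nz by simp
  qed
  then show ?thesis by simp
qed

text \<open>The fractions \<open>m / n\<close> with \<open>1 \<le> m \<le> n\<close> are sorted by
  their reduced form \<open>j / d\<close>.\<close>

lemma prod_cyclotomic_divisors: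
  assumes "n > 0"
  shows "(\<Prod>d | d dvd n. cyclotomic d) = monom 1 n - 1"
proof -
  let ?e = "\<lambda>j n :: nat. [:- exp (2 * of_real pi * \<i> * of_nat j / of_nat n), 1:]"
  have "(\<Prod>d | d dvd n. cyclotomic d)
    = (\<Prod>(d, j) \<in> (SIGMA d:{d. d dvd n}. {j. 1 \<le> j \<and> j \<le> d \<and> coprime j d}). ?e j d)"
    unfolding cyclotomic_def using assms
    by (intro prod.Sigma) (auto intro: finite_subset[of _ "{..x}" for x])
  also have "\<dots> = (\<Prod>m\<in>{1..n}. ?e m n)"
  proof (rule prod.reindex_bij_witness[where
        i = "\<lambda>m. (n div gcd m n, m div gcd m n)" and j = "\<lambda>(d, j). j * (n div d)"])
    fix a assume "a \<in> (SIGMA d:{d. d dvd n}. {j. 1 \<le> j \<and> j \<le> d \<and> coprime j d})"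
    then obtain d j c where a: "a = (d, j)" and n: "n = d * c" and j: "1 \<le> j" "j \<le> d" "coprime j d"
      by (auto simp: dvd_def)
    have pos: "d > 0" "c > 0"
      using assms n by auto
    have g: "gcd (j * c) (d * c) = c"
      using j(3) by (simp add: gcd_mult_distrib_nat [symmetric] mult.commute)
    show "(n div gcd (case a of (d, j) \<Rightarrow> j * (n div d)) n,
        (case a of (d, j) \<Rightarrow> j * (n div d)) div gcd (case a of (d, j) \<Rightarrow> j * (n div d)) n) = a"
      using pos by (simp add: a n g)
    show "(case a of (d, j) \<Rightarrow> j * (n div d)) \<in> {1..n}"
      using pos j by (simp add: a n)
    show "?e (case a of (d, j) \<Rightarrow> j * (n div d)) n = (case a of (d, j) \<Rightarrow> ?e j d)"
      using pos by (simp add: a n mult.assoc)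
  next
    fix m assume m: "m \<in> {1..n}"
    define g where "g = gcd m n"
    have g: "g > 0" "g dvd m" "g dvd n"
      using m by (auto simp: g_def)
    then obtain a b where ab: "m = g * a" "n = g * b"
      by (auto simp: dvd_def)
    have b: "b > 0"
      using assms ab by auto
    show "(case (n div gcd m n, m div gcd m n) of (d, j) \<Rightarrow> j * (n div d)) = m"
      unfolding g_def [symmetric] using g b by (simp add: ab)
    have "coprime (m div g) (n div g)"
      unfolding g_def using assms by (simp add: div_gcd_coprime)
    then show "(n div gcd m n, m div gcd m n) \<in> (SIGMA d:{d. d dvd n}. {j. 1 \<le> j \<and> j \<le> d \<and> coprime j d})"
      unfolding g_def [symmetric] using g b m by (auto simp: ab)
  qed
  also have "\<dots> = monom 1 n - 1"
    using assms by (rule prod_root_unity_linear_factors)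
  finally show ?thesis .
qed


text \<open>The power \<open>(1 - X\<^sup>d)\<^sup>a\<close> for an integer exponent \<open>a\<close>.\<close>

definition one_minus_X_pow :: "nat \<Rightarrow> int \<Rightarrow> complex fps" where
  "one_minus_X_pow d a = fps_binomial (of_int a) oo (- (fps_X ^ d))"

lemma one_minus_X_pow_0 [simp]: "one_minus_X_pow d 0 = 1"
  by (simp add: one_minus_X_pow_def)

lemma one_minus_X_pow_1: "d > 0 \<Longrightarrow> one_minus_X_pow d 1 = 1 - fps_X ^ d"
  by (simp add: one_minus_X_pow_def fps_binomial_1 fps_compose_add_distrib)

lemma one_minus_X_pow_add:
  "d > 0 \<Longrightarrow> one_minus_X_pow d (a + b) = one_minus_X_pow d a * one_minus_X_pow d b"
  by (simp add: one_minus_X_pow_def fps_binomial_add_mult fps_compose_mult_distrib)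

lemma one_minus_X_pow_sum:
  "d > 0 \<Longrightarrow> one_minus_X_pow d (\<Sum>i\<in>A. f i) = (\<Prod>i\<in>A. one_minus_X_pow d (f i))"
  by (induction A rule: infinite_finite_induct) (auto simp: one_minus_X_pow_add)

lemma one_minus_X_pow_nonzero: "d > 0 \<Longrightarrow> one_minus_X_pow d a \<noteq> 0"
  using one_minus_X_pow_add[of d a "- a"] by auto

lemma one_minus_X_pow_nth:
  assumes "d > 0"
  shows "one_minus_X_pow d a $ m =
    (if d dvd m then (-1) ^ (m div d) * (of_int a gchoose (m div d)) else 0)"
proof -
  have "(- (fps_X ^ d) :: complex fps) ^ i $ m = (if m = d * i then (-1) ^ i else 0)" for i
  proof -
    have "(- (fps_X ^ d) :: complex fps) ^ i = (-1) ^ i * fps_X ^ (d * i)"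
      by (subst power_minus) (simp add: power_mult)
    also have "(-1) ^ i = (fps_const ((-1) ^ i) :: complex fps)"
      by (metis fps_const_neg fps_const_power fps_const_1_eq_1)
    finally have eq: "(- (fps_X ^ d) :: complex fps) ^ i = fps_const ((-1) ^ i) * fps_X ^ (d * i)" .
    show ?thesis
      unfolding eq by simp
  qed
  then have "one_minus_X_pow d a $ m
    = (\<Sum>i=0..m. if m = d * i then (-1) ^ i * (of_int a gchoose i) else 0)"
    unfolding one_minus_X_pow_def fps_compose_nth
    by (auto intro!: sum.cong)
  also have "\<dots> = (\<Sum>i=0..m. if i = m div d then
      (if d dvd m then (-1) ^ i * (of_int a gchoose i) else 0) else 0)"
    using assms by (intro sum.cong) auto
  also have "\<dots> = (if d dvd m then (-1) ^ (m div d) * (of_int a gchoose (m div d)) else 0)"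
    by (subst sum.delta) auto
  finally show ?thesis .
qed

text \<open>Moebius inversion in multiplicative form: the total exponent of the factor belonging to
  \<open>e\<close> is the divisor sum of mu over \<open>n div e\<close>, which is 1 for
  \<open>e = n\<close> and 0 otherwise.\<close>

lemma prod_moebius_one_minus_X_pow_divisors:
  assumes "n > 0"
  shows "(\<Prod>d | d dvd n. \<Prod>e | e dvd d. one_minus_X_pow e (moebius_mu (d div e))) = 1 - fps_X ^ n"
proof -
  have "(\<Prod>d | d dvd n. \<Prod>e | e dvd d. one_minus_X_pow e (moebius_mu (d div e)))
    = (\<Prod>d\<in>{d. d dvd n}. \<Prod>e\<in>{e\<in>{e. e dvd n}. e dvd d}. one_minus_X_pow e (moebius_mu (d div e)))"
    by (intro prod.cong) (auto intro: dvd_trans)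
  also have "\<dots> = (\<Prod>e\<in>{e. e dvd n}. \<Prod>d\<in>{d\<in>{d. d dvd n}. e dvd d}. one_minus_X_pow e (moebius_mu (d div e)))"
    using assms by (intro prod.swap_restrict) auto
  also have "\<dots> = (\<Prod>e\<in>{e. e dvd n}. if e = n then 1 - fps_X ^ n else 1)"
  proof (rule prod.cong [OF refl])
    fix e assume "e \<in> {e. e dvd n}"
    then obtain c where c: "n = e * c" by auto
    then have pos: "e > 0" "c > 0"
      using assms by auto
    have "(\<Prod>d\<in>{d\<in>{d. d dvd n}. e dvd d}. one_minus_X_pow e (moebius_mu (d div e)))
      = one_minus_X_pow e (\<Sum>d\<in>{d\<in>{d. d dvd n}. e dvd d}. moebius_mu (d div e))"
      using pos by (simp add: one_minus_X_pow_sum)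
    also have "(\<Sum>d\<in>{d\<in>{d. d dvd n}. e dvd d}. moebius_mu (d div e)) = (\<Sum>d | d dvd c. moebius_mu d)"
      by (rule sum.reindex_bij_witness[where i = "\<lambda>d. e * d" and j = "\<lambda>d. d div e"])
        (use pos c in auto)
    also have "\<dots> = (if e = n then 1 else 0)"
      using sum_moebius_mu_divisors[OF pos(2)] c pos by auto
    finally show "(\<Prod>d\<in>{d\<in>{d. d dvd n}. e dvd d}. one_minus_X_pow e (moebius_mu (d div e)))
      = (if e = n then 1 - fps_X ^ n else 1)"
      using pos one_minus_X_pow_1[of e] by auto
  qed
  also have "\<dots> = 1 - fps_X ^ n"
    using assms by (subst prod.delta) auto
  finally show ?thesis .
qed

text \<open>Both sides have the same product over the divisors of \<open>n\<close>, so induction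
  cancels the proper divisors. A single sign, attached to \<open>d = 1\<close>, accounts for the
  change from \<open>1 - X^n\<close> to \<open>X^n - 1\<close> for every \<open>n\<close>.\<close>

lemma fps_of_poly_cyclotomic:
  assumes "n > 0"
  shows "fps_of_poly (cyclotomic n) =
    (if n = 1 then -1 else 1) * (\<Prod>e | e dvd n. one_minus_X_pow e (moebius_mu (n div e)))"
  using assms
proof (induction n rule: less_induct)
  case (less n)
  define c where "c = (\<lambda>n::nat. (if n = 1 then -1 else 1) :: complex fps)"
  define F where "F = (\<lambda>n. c n * (\<Prod>e | e dvd n. one_minus_X_pow e (moebius_mu (n div e))))"
  let ?D = "{d. d dvd n}"
  have fin: "finite ?D"
    using less.prems by simp
  have "prod F ?D = prod c ?D * (1 - fps_X ^ n)"
    unfolding F_def prod.distrib prod_moebius_one_minus_X_pow_divisors[OF less.prems] ..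
  also have "prod c ?D = -1"
    unfolding c_def using fin less.prems by (subst prod.delta) auto
  also have "-1 * (1 - fps_X ^ n) = fps_of_poly (monom 1 n - 1 :: complex poly)"
    by (simp add: fps_of_poly_diff fps_of_poly_monom)
  also have "\<dots> = (\<Prod>d\<in>?D. fps_of_poly (cyclotomic d))"
    by (simp add: prod_cyclotomic_divisors[OF less.prems, symmetric] fps_of_poly_prod)
  finally have eq: "prod F ?D = (\<Prod>d\<in>?D. fps_of_poly (cyclotomic d))" .
  have IH: "fps_of_poly (cyclotomic d) = F d" if "d \<in> ?D - {n}" for d
  proof -
    have "d < n" "d > 0"
      using that less.prems dvd_imp_le[of d n] by (auto intro: Nat.gr0I)
    then show ?thesis
      using less.IH[of d] by (simp add: F_def c_def)
  qed
  have "fps_of_poly (cyclotomic n) * prod F (?D - {n}) = (\<Prod>d\<in>?D. fps_of_poly (cyclotomic d))"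
    using fin by (subst prod.remove[of _ n]) (auto simp: IH intro!: prod.cong)
  also have "\<dots> = F n * prod F (?D - {n})"
    using fin by (subst eq [symmetric], subst prod.remove[of _ n]) auto
  finally have "fps_of_poly (cyclotomic n) * prod F (?D - {n}) = F n * prod F (?D - {n})" .
  moreover have "prod F (?D - {n}) \<noteq> 0"
  proof (subst prod_zero_iff)
    show "finite (?D - {n})" using fin by simp
    show "\<not> (\<exists>a\<in>?D - {n}. F a = 0)"
    proof safe
      fix d assume d: "d dvd n" "F d = 0"
      then have "d > 0" using less.prems by (auto intro: Nat.gr0I)
      then have "finite {e. e dvd d}" and "\<And>e. e dvd d \<Longrightarrow> e > 0" by (auto intro: Nat.gr0I)
      then have "(\<Prod>e | e dvd d. one_minus_X_pow e (moebius_mu (d div e))) \<noteq> 0"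
        by (auto simp: one_minus_X_pow_nonzero)
      then show "d = n" using d(2) by (auto simp: F_def c_def split: if_splits)
    qed
  qed
  ultimately show ?case
    by (simp add: F_def c_def)
qed

section \<open>Coefficients as sums over partitions\<close>

lemma finite_partitions: "finite (partitions k)"
proof (rule finite_subset)
  show "partitions k \<subseteq> (\<Union>j\<le>k. {M. size M = j \<and> set_mset M \<subseteq> {..k}})"
  proof
    fix P assume "P \<in> partitions k"
    then have P: "0 \<notin># P" "sum_mset P = k" by (auto simp: partitions_def)
    from P(1) have "size P \<le> sum_mset P"
      by (induction P) auto
    moreover have "d \<le> k" if "d \<in># P" for d
      using that P(2) by (auto dest!: multi_member_split)
    ultimately show "P \<in> (\<Union>j\<le>k. {M. size M = j \<and> set_mset M \<subseteq> {..k}})"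
      using P(2) by auto
  qed
  show "finite (\<Union>j\<le>k. {M. size M = j \<and> set_mset M \<subseteq> {..k}})"
  proof (intro finite_UN_I)
    show "finite {M. size M = j \<and> set_mset M \<subseteq> {..k}}" for j
      using finite_multisets_of_size[of "{..k}" j] by (simp add: multisets_of_size_def conj_commute)
  qed auto
qed

text \<open>Taking the power \<open>X^i\<close> from the factor of \<open>d\<close> amounts to using
  the part \<open>d\<close> exactly \<open>i div d\<close> times. Adjoining \<open>d\<close> to
  \<open>D\<close> therefore matches pairs of such an \<open>i\<close> and a partition of
  \<open>k - i\<close> with partitions of \<open>k\<close>.\<close>

lemma prod_one_minus_X_pow_nth:
  fixes a :: "nat \<Rightarrow> int"
  assumes "finite D" "0 \<notin> D"
  shows "(\<Prod>d\<in>D. one_minus_X_pow d (a d)) $ k =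
    (\<Sum>P | P \<in> partitions k \<and> set_mset P \<subseteq> D.
       \<Prod>d\<in>set_mset P. (-1) ^ count P d * (of_int (a d) gchoose count P d))"
  using assms
proof (induction D arbitrary: k rule: finite_induct)
  case empty
  have "{P \<in> partitions k. set_mset P \<subseteq> {}} = (if k = 0 then {{#}} else {})"
    by (auto simp: partitions_def)
  then show ?case
    by (auto simp del: set_mset_eq_empty_iff)
next
  case (insert d D)
  define w where "w = (\<lambda>P. \<Prod>d\<in>set_mset P. (-1) ^ count P d * (of_int (a d) gchoose count P d) :: complex)"
  define b where "b = (\<lambda>j. (-1) ^ j * (of_int (a d) gchoose j) :: complex)"
  have d: "d > 0" and D: "0 \<notin> D"
    using insert.prems by auto
  have "(\<Prod>d\<in>insert d D. one_minus_X_pow d (a d)) $ k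
    = (\<Sum>i=0..k. (if d dvd i then b (i div d) else 0) * (\<Prod>d\<in>D. one_minus_X_pow d (a d)) $ (k - i))"
    unfolding b_def using insert.hyps d by (simp add: fps_mult_nth one_minus_X_pow_nth)
  also have "\<dots> = (\<Sum>i\<in>{i\<in>{0..k}. d dvd i}. b (i div d) * (\<Prod>d\<in>D. one_minus_X_pow d (a d)) $ (k - i))"
    by (subst sum.inter_filter) (auto intro!: sum.cong)
  also have "\<dots> = (\<Sum>i\<in>{i\<in>{0..k}. d dvd i}. \<Sum>P | P \<in> partitions (k - i) \<and> set_mset P \<subseteq> D. b (i div d) * w P)"
    by (simp add: insert.IH[OF D] w_def sum_distrib_left)
  also have "\<dots> = (\<Sum>(i, P)\<in>(SIGMA i:{i\<in>{0..k}. d dvd i}. {P \<in> partitions (k - i). set_mset P \<subseteq> D}). b (i div d) * w P)"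
    by (intro sum.Sigma) (auto intro: finite_subset[OF _ finite_partitions])
  also have "\<dots> = (\<Sum>P | P \<in> partitions k \<and> set_mset P \<subseteq> insert d D. w P)"
  proof (rule sum.reindex_bij_witness[where
        i = "\<lambda>P. (count P d * d, filter_mset (\<lambda>x. x \<noteq> d) P)" and
        j = "\<lambda>(i, P). P + replicate_mset (i div d) d"])
    fix x assume "x \<in> (SIGMA i:{i\<in>{0..k}. d dvd i}. {P \<in> partitions (k - i). set_mset P \<subseteq> D})"
    then obtain i P where x: "x = (i, P)" "i \<le> k" "d dvd i" "P \<in> partitions (k - i)" "set_mset P \<subseteq> D"
      by auto
    have nd: "d \<notin># P"
      using x insert.hyps by auto
    let ?j = "\<lambda>(i, P). P + replicate_mset (i div d) d"
    show "(count (?j x) d * d, filter_mset (\<lambda>x. x \<noteq> d) (?j x)) = x"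
    proof -
      have "filter_mset (\<lambda>x. x \<noteq> d) P = P"
        using nd by (induction P) auto
      moreover have "filter_mset (\<lambda>x. x \<noteq> d) (replicate_mset m d) = {#}" for m
        by (induction m) auto
      ultimately show ?thesis
        using x nd by (simp add: not_in_iff)
    qed
    show "?j x \<in> {P \<in> partitions k. set_mset P \<subseteq> insert d D}"
      using x d by (auto simp: partitions_def sum_mset_replicate_mset in_replicate_mset split: if_splits)
    have "w (?j x) = b (i div d) * w P"
    \<comment> \<open>With multiplicity 0 the part \<open>d\<close> is absent from the product
      defining \<open>w\<close>, and \<open>b 0 = 1\<close> agrees with this.\<close>
    proof (cases "i div d = 0")
      case False
      then have "set_mset (P + replicate_mset (i div d) d) = insert d (set_mset P)"
        by auto
      then have "w (?j x) = b (i div d) * (\<Prod>e\<in>set_mset P. (-1) ^ count (P + replicate_mset (i div d) d) e *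
           (of_int (a e) gchoose count (P + replicate_mset (i div d) d) e))"
        using nd by (simp add: x w_def b_def not_in_iff)
      also have "(\<Prod>e\<in>set_mset P. (-1) ^ count (P + replicate_mset (i div d) d) e *
           (of_int (a e) gchoose count (P + replicate_mset (i div d) d) e)) = w P"
        unfolding w_def using nd by (intro prod.cong) auto
      finally show ?thesis .
    qed (simp add: x b_def)
    then show "w (?j x) = (case x of (i, P) \<Rightarrow> b (i div d) * w P)"
      by (simp add: x)
  next
    fix P assume "P \<in> {P \<in> partitions k. set_mset P \<subseteq> insert d D}"
    then have P: "P \<in> partitions k" "set_mset P \<subseteq> insert d D" by auto
    have split: "filter_mset (\<lambda>x. x \<noteq> d) P + replicate_mset (count P d) d = P"
      by (metis filter_eq_replicate_mset multiset_partition add.commute)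
    show "(case (count P d * d, filter_mset (\<lambda>x. x \<noteq> d) P) of (i, P) \<Rightarrow> P + replicate_mset (i div d) d) = P"
      using d split by simp
    have "sum_mset (filter_mset (\<lambda>x. x \<noteq> d) P) + count P d * d = k"
      using arg_cong[OF split, of sum_mset] P(1) by (simp add: partitions_def)
    then show "(count P d * d, filter_mset (\<lambda>x. x \<noteq> d) P)
      \<in> (SIGMA i:{i\<in>{0..k}. d dvd i}. {P \<in> partitions (k - i). set_mset P \<subseteq> D})"
      using P by (auto simp: partitions_def)
  qed
  finally show ?case
    by (simp add: w_def)
qed

text \<open>All parts divide \<open>n\<close> exactly when their lcm does. Putting this condition
  inside the sum makes the index set finite and independent of \<open>n\<close>, so that means can
  be taken partition by partition.\<close>

lemma cyc_coeff_eq_sum_partitions: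
  assumes "n > 1"
  shows "cyc_coeff n k = (\<Sum>P\<in>partitions k. if part_lcm P dvd n then
     \<Prod>d\<in>set_mset P. (-1) ^ count P d * (of_int (moebius_mu (n div d)) gchoose count P d) else 0)"
proof -
  have "cyc_coeff n k = fps_of_poly (cyclotomic n) $ k"
    by (simp add: cyc_coeff_def)
  also have "\<dots> = (\<Prod>d\<in>{d. d dvd n}. one_minus_X_pow d (moebius_mu (n div d))) $ k"
    using assms by (simp add: fps_of_poly_cyclotomic)
  also have "\<dots> = (\<Sum>P | P \<in> partitions k \<and> set_mset P \<subseteq> {d. d dvd n}.
       \<Prod>d\<in>set_mset P. (-1) ^ count P d * (of_int (moebius_mu (n div d)) gchoose count P d))"
    using assms by (intro prod_one_minus_X_pow_nth) auto
  also have "{P. P \<in> partitions k \<and> set_mset P \<subseteq> {d. d dvd n}} = {P \<in> partitions k. part_lcm P dvd n}"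
    by (auto simp: part_lcm_def Lcm_dvd_iff)
  finally show ?thesis
    by (simp add: sum.inter_filter finite_partitions)
qed

section \<open>Contribution of a partition\<close>

lemma of_real_gchoose: "of_real (x gchoose j) = (of_real x gchoose j :: complex)"
  by (simp add: gbinomial_prod_rev)

text \<open>An element \<open>d\<close> of least \<open>p\<close>-adic valuation \<open>v\<close>
  works: \<open>p ^ v\<close> divides the gcd, hence \<open>p ^ (v + j)\<close> divides
  \<open>L\<close>, and dividing by \<open>d\<close> removes only \<open>p ^ v\<close>. The case
  \<open>j = 1\<close> yields the coprimality condition, \<open>j = 2\<close> the squarefreeness of
  the quotient.\<close>

lemma prime_power_dvd_lcm_div_Gcd:
  fixes T :: "nat set"
  assumes "finite T" "T \<noteq> {}" "L > 0" "\<And>d. d \<in> T \<Longrightarrow> d dvd L"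
    and "prime p" "p ^ j dvd L div Gcd T"
  obtains d where "d \<in> T" "p ^ j dvd L div d"
proof -
  have nz: "d > 0" if "d \<in> T" for d
    using assms(3,4) that by (metis dvd_0_left_iff neq0_conv)
  define v where "v = Min (multiplicity p ` T)"
  have "v \<in> multiplicity p ` T"
    unfolding v_def using assms(1,2) by (intro Min_in) auto
  then obtain d where d: "d \<in> T" "multiplicity p d = v" by auto
  have "p ^ v dvd e" if "e \<in> T" for e
  proof -
    have "v \<le> multiplicity p e"
      unfolding v_def using assms(1) that by (intro Min_le) auto
    then show ?thesis by (rule multiplicity_dvd')
  qed
  then have vG: "p ^ v dvd Gcd T" by (rule Gcd_greatest)
  have Gd: "Gcd T dvd d" using d(1) by (rule Gcd_dvd)
  have dL: "d dvd L" using assms(4) d(1) by blast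
  then have GL: "Gcd T dvd L" using Gd dvd_trans by blast
  have "p ^ v * p ^ j dvd Gcd T * (L div Gcd T)"
    using vG assms(6) by (rule mult_dvd_mono)
  then have "p ^ (v + j) dvd L"
    using GL by (simp add: power_add)
  then have "v + j \<le> multiplicity p L"
    using assms(3,5) by (subst (asm) power_dvd_iff_le_multiplicity) auto
  also have "multiplicity p L = multiplicity p (d * (L div d))"
    using dL by simp
  also have "\<dots> = v + multiplicity p (L div d)"
    using assms(3,5) d dL nz[OF d(1)]
    by (subst prime_elem_multiplicity_mult_distrib) (auto simp: dvd_div_eq_0_iff)
  finally have "p ^ j dvd L div d"
    by (intro multiplicity_dvd') simp
  then show ?thesis using d(1) that by blast
qed

lemma squarefree_eq_prod_primes:
  fixes n :: nat
  assumes "squarefree n"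
  shows "n = (\<Prod>p | prime p \<and> p dvd n. p)"
proof -
  have n: "n > 0" using assms by (intro Nat.gr0I) auto
  have "n = (\<Prod>p\<in>prime_factors n. p ^ multiplicity p n)"
    using n prime_factorization_nat by blast
  also have "\<dots> = (\<Prod>p\<in>prime_factors n. p)"
    using assms n by (intro prod.cong) (auto simp: squarefree_factorial_semiring')
  also have "prime_factors n = {p. prime p \<and> p dvd n}"
    using n by (auto simp: in_prime_factors_iff)
  finally show ?thesis .
qed

context
  fixes P :: "nat multiset" and k :: nat
  assumes P: "P \<in> partitions k" and k: "k \<ge> 1"
begin

lemma partition_nonempty: "set_mset P \<noteq> {}"
  using P k by (auto simp: partitions_def)

lemma part_pos: "d \<in># P \<Longrightarrow> d > 0"
  using P by (auto simp: partitions_def intro: Nat.gr0I)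

lemma part_lcm_pos: "part_lcm P > 0"
  using P by (auto simp: part_lcm_def partitions_def Lcm_0_iff intro!: Nat.gr0I)

lemma part_dvd_part_lcm: "d \<in># P \<Longrightarrow> d dvd part_lcm P"
  by (simp add: part_lcm_def dvd_Lcm)

lemma part_gcd_dvd_part_lcm: "part_gcd P dvd part_lcm P"
  using partition_nonempty part_dvd_part_lcm
  by (metis Gcd_dvd dvd_trans ex_in_conv part_gcd_def)

lemma part_gcd_pos: "part_gcd P > 0"
  using part_gcd_dvd_part_lcm part_lcm_pos by (metis dvd_0_left_iff neq0_conv)

lemma prime_power_dvd_part_quotient:
  assumes "prime p" "p ^ j dvd part_lcm P div part_gcd P"
  obtains d where "d \<in># P" "p ^ j dvd part_lcm P div d"
proof (rule prime_power_dvd_lcm_div_Gcd[of "set_mset P" "part_lcm P" p j])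
  show "p ^ j dvd part_lcm P div Gcd (set_mset P)"
    using assms(2) by (simp add: part_gcd_def)
qed (use assms(1) partition_nonempty part_lcm_pos part_dvd_part_lcm that in auto)

lemma part_quotient_dvd:
  assumes "d \<in># P"
  shows "part_lcm P div d dvd part_lcm P div part_gcd P"
proof -
  obtain a where a: "d = part_gcd P * a"
    using assms by (metis Gcd_dvd dvdE part_gcd_def)
  obtain b where b: "part_lcm P = d * b"
    using part_dvd_part_lcm[OF assms] by (elim dvdE)
  have "part_lcm P div d = b"
    using b part_pos[OF assms] by simp
  moreover have "part_lcm P div part_gcd P = a * b"
    using a b part_gcd_pos by (simp add: mult.assoc)
  ultimately show ?thesis by simp
qed

text \<open>A part that occurs has positive multiplicity, and 0 over a positive integer is 0. One
  vanishing Moebius exponent thus annihilates the whole term.\<close>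

lemma prod_gchoose_eq_0:
  fixes c :: "nat \<Rightarrow> int"
  assumes "d \<in># P" "c d = 0"
  shows "(\<Prod>d\<in>set_mset P. (-1) ^ count P d * (real_of_int (c d) gchoose count P d)) = 0"
proof (rule prod_zero)
  have "count P d \<noteq> 0"
    using assms(1) by simp
  then have "(-1) ^ count P d * (real_of_int (c d) gchoose count P d) = 0"
    using assms(2) by (simp add: gbinomial_0_left)
  then show "\<exists>d\<in>set_mset P. (-1) ^ count P d * (real_of_int (c d) gchoose count P d) = 0"
    using assms(1) by blast
qed auto

text \<open>For \<open>m\<close> coprime to the quotient the term is
  \<open>A (moebius_mu m)\<close>, and \<open>A 0 = 0\<close>. The right-hand side interpolates such
  a function on {-1, 0, 1} by its even and odd parts.\<close>

lemma partition_term_eq: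
  defines "A \<equiv> \<lambda>s. \<Prod>d\<in>set_mset P. (-1) ^ count P d *
    (real_of_int (s * moebius_mu (part_lcm P div d)) gchoose count P d)"
  shows "(\<Prod>d\<in>set_mset P. (-1) ^ count P d *
      (real_of_int (moebius_mu (part_lcm P * m div d)) gchoose count P d))
    = (A 1 + A (-1)) / 2 * (if \<forall>p\<in>{p. prime p \<and> p dvd part_lcm P div part_gcd P}. \<not> p dvd m
         then (real_of_int (moebius_mu m))\<^sup>2 else 0)
    + (A 1 - A (-1)) / 2 * (if \<forall>p\<in>{p. prime p \<and> p dvd part_lcm P div part_gcd P}. \<not> p dvd m
         then real_of_int (moebius_mu m) else 0)"
proof -
  have div_eq: "part_lcm P * m div d = m * (part_lcm P div d)" if "d \<in># P" for d
    using part_dvd_part_lcm[OF that] by (metis div_mult_swap mult.commute)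
  show ?thesis
  proof (cases "\<forall>p\<in>{p. prime p \<and> p dvd part_lcm P div part_gcd P}. \<not> p dvd m")
    case True
    have "coprime m (part_lcm P div part_gcd P)"
    proof (rule ccontr)
      assume "\<not> coprime m (part_lcm P div part_gcd P)"
      then obtain p where "prime p" "p dvd m" "p dvd part_lcm P div part_gcd P"
        using prime_factor_nat[of "gcd m (part_lcm P div part_gcd P)"]
        by (auto simp: coprime_iff_gcd_eq_1)
      then show False using True by blast
    qed
    then have cop: "coprime m (part_lcm P div d)" if "d \<in># P" for d
      using part_quotient_dvd[OF that] by (rule coprime_divisors[OF dvd_refl, rotated])
    have eq: "(\<Prod>d\<in>set_mset P. (-1) ^ count P d *
        (real_of_int (moebius_mu (part_lcm P * m div d)) gchoose count P d)) = A (moebius_mu m)"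
      unfolding A_def
    proof (rule prod.cong [OF refl])
      fix d assume "d \<in># P"
      then have "moebius_mu (part_lcm P * m div d) = moebius_mu m * moebius_mu (part_lcm P div d)"
        by (simp only: div_eq cop moebius_mu_mult_coprime)
      then show "(-1) ^ count P d * (real_of_int (moebius_mu (part_lcm P * m div d)) gchoose count P d)
        = (-1) ^ count P d * (real_of_int (moebius_mu m * moebius_mu (part_lcm P div d)) gchoose count P d)"
        by simp
    qed
    obtain d where "d \<in># P" using partition_nonempty by blast
    then have A0: "A 0 = 0"
      using prod_gchoose_eq_0[of d "\<lambda>_. 0"] by (simp add: A_def)
    consider "moebius_mu m = 0" | "moebius_mu m = 1" | "moebius_mu m = -1"
      using moebius_mu_cases by blast
    then show ?thesis
      using True A0 unfolding eq by cases (simp_all add: field_simps)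
  next
    case False
    then obtain p where p: "prime p" "p dvd part_lcm P div part_gcd P" "p dvd m" by blast
    \<comment> \<open>For this part \<open>p\<close> divides both \<open>m\<close> and
      \<open>part_lcm P div d\<close>, so its Moebius argument is divisible by the square of
      \<open>p\<close> and the term vanishes.\<close>
    obtain d where d: "d \<in># P" "p ^ 1 dvd part_lcm P div d"
      using prime_power_dvd_part_quotient[of p 1] p by auto
    have "p\<^sup>2 dvd part_lcm P * m div d"
      unfolding div_eq[OF d(1)] power2_eq_square using p(3) d(2) by (intro mult_dvd_mono) auto
    moreover have "\<not> p dvd 1" using p(1) not_prime_unit by blast
    ultimately have "moebius_mu (part_lcm P * m div d) = 0"
      by (simp add: moebius_mu_eq_0_iff not_squarefreeI)
    then have "(\<Prod>d\<in>set_mset P. (-1) ^ count P d *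
      (real_of_int (moebius_mu (part_lcm P * m div d)) gchoose count P d)) = 0"
      by (rule prod_gchoose_eq_0[OF d(1)])
    then show ?thesis using False by auto
  qed
qed

lemma part_eps_eq_0:
  assumes "\<not> squarefree (part_lcm P div part_gcd P)"
  shows "part_eps P = 0"
proof -
  have "part_lcm P div part_gcd P \<noteq> 0"
    using part_gcd_dvd_part_lcm part_lcm_pos by (auto simp: dvd_div_eq_0_iff)
  then obtain p where p: "prime p" "p\<^sup>2 dvd part_lcm P div part_gcd P"
    using assms by (auto simp: squarefree_factorial_semiring)
  then obtain d where d: "d \<in># P" "p\<^sup>2 dvd part_lcm P div d"
    using prime_power_dvd_part_quotient by blast
  have "\<not> p dvd 1" using p(1) not_prime_unit by blast
  then have "moebius_mu (part_lcm P div d) = 0" "- moebius_mu (part_lcm P div d) = 0"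
    using d(2) by (simp_all add: moebius_mu_eq_0_iff not_squarefreeI)
  note zero = prod_gchoose_eq_0[OF d(1), of "\<lambda>d. moebius_mu (part_lcm P div d)", OF this(1)]
    prod_gchoose_eq_0[OF d(1), of "\<lambda>d. - moebius_mu (part_lcm P div d)", OF this(2)]
  show ?thesis
    unfolding part_eps_def zero by simp
qed

text \<open>The odd part is weighted by the mean 0 of the sieved mu, while the even part carries the
  sieved mean of its square. Dilation by the lcm then converts the mean over \<open>m\<close> into
  one over \<open>n\<close>.\<close>

lemma nat_mean_partition_term:
  "nat_mean (\<lambda>n. if part_lcm P dvd n then
      \<Prod>d\<in>set_mset P. (-1) ^ count P d * (real_of_int (moebius_mu (n div d)) gchoose count P d) else 0)
    (3 / pi\<^sup>2 * (part_eps P / (real (part_gcd P) *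
      (\<Prod>p | prime p \<and> p dvd part_lcm P div part_gcd P. real p + 1))))"
proof -
  define L where "L = part_lcm P"
  define Q where "Q = {p. prime p \<and> p dvd part_lcm P div part_gcd P}"
  define A where "A = (\<lambda>s. \<Prod>d\<in>set_mset P. (-1) ^ count P d *
    (real_of_int (s * moebius_mu (L div d)) gchoose count P d))"
  define g where "g = (\<lambda>m. (A 1 + A (-1)) / 2 * (if \<forall>p\<in>Q. \<not> p dvd m then (real_of_int (moebius_mu m))\<^sup>2 else 0)
    + (A 1 - A (-1)) / 2 * (if \<forall>p\<in>Q. \<not> p dvd m then real_of_int (moebius_mu m) else 0))"
  have eps: "part_eps P = A 1 + A (-1)"
    by (simp add: part_eps_def A_def L_def)
  have nz: "part_lcm P div part_gcd P > 0"
    using part_gcd_dvd_part_lcm part_lcm_pos by (auto simp: dvd_div_eq_0_iff intro!: Nat.gr0I)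
  have Q: "finite Q" "\<And>p. p \<in> Q \<Longrightarrow> prime p"
    using nz by (auto simp: Q_def)
  have mu_abs: "\<bar>real_of_int (moebius_mu n)\<bar> \<le> 1" for n
    using moebius_mu_cases[of n] by auto
  have "nat_mean (\<lambda>n. if \<forall>p\<in>Q. \<not> p dvd n then real_of_int (moebius_mu n) else 0)
      (0 / (\<Prod>p\<in>Q. 1 + (-1) / real p))"
    using Q mu_abs nat_mean_moebius_mu
    by (intro nat_mean_sieve) (auto simp: moebius_mu_prime_mult)
  moreover have "nat_mean (\<lambda>n. if \<forall>p\<in>Q. \<not> p dvd n then (real_of_int (moebius_mu n))\<^sup>2 else 0)
      (6 / pi\<^sup>2 / (\<Prod>p\<in>Q. 1 + 1 / real p))"
    using Q mu_abs nat_mean_moebius_mu_squared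
    by (intro nat_mean_sieve) (auto simp: moebius_mu_prime_mult abs_square_le_1)
  ultimately have "nat_mean g ((A 1 + A (-1)) / 2 * (6 / pi\<^sup>2 / (\<Prod>p\<in>Q. 1 + 1 / real p))
      + (A 1 - A (-1)) / 2 * (0 / (\<Prod>p\<in>Q. 1 + (-1) / real p)))"
    unfolding g_def by (intro nat_mean_lincomb)
  then have "nat_mean g (3 / pi\<^sup>2 * part_eps P / (\<Prod>p\<in>Q. 1 + 1 / real p))"
    by (simp add: eps add_divide_distrib distrib_left)
  then have "nat_mean (\<lambda>n. if L dvd n then g (n div L) else 0)
      (3 / pi\<^sup>2 * part_eps P / (\<Prod>p\<in>Q. 1 + 1 / real p) / real L)"
    using part_lcm_pos by (intro nat_mean_dilate) (simp_all add: L_def)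
  moreover have "(if L dvd n then g (n div L) else 0) = (if part_lcm P dvd n then
      \<Prod>d\<in>set_mset P. (-1) ^ count P d * (real_of_int (moebius_mu (n div d)) gchoose count P d) else 0)" for n
  proof (cases "L dvd n")
    case True
    then obtain m where m: "n = L * m" by (elim dvdE)
    have "n div L = m" using m part_lcm_pos by (simp add: L_def)
    then show ?thesis
      using partition_term_eq[of m] by (simp add: m L_def g_def A_def Q_def)
  qed (simp add: L_def)
  \<comment> \<open>If the quotient is squarefree, it is the product of the primes in
    \<open>Q\<close>, and multiplying each into \<open>1 + 1 / p\<close> gives \<open>p + 1\<close>.
    Otherwise both sides are 0 because \<open>part_eps P\<close> is.\<close>
  moreover have "3 / pi\<^sup>2 * part_eps P / (\<Prod>p\<in>Q. 1 + 1 / real p) / real L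
    = 3 / pi\<^sup>2 * (part_eps P / (real (part_gcd P) * (\<Prod>p\<in>Q. real p + 1)))"
  proof (cases "squarefree (part_lcm P div part_gcd P)")
    case False
    then show ?thesis by (simp add: part_eps_eq_0)
  next
    case True
    have "real L = real (part_gcd P) * real (part_lcm P div part_gcd P)"
      using part_gcd_dvd_part_lcm by (simp add: L_def flip: of_nat_mult)
    also have "part_lcm P div part_gcd P = (\<Prod>p\<in>Q. p)"
      unfolding Q_def using True by (rule squarefree_eq_prod_primes)
    finally have "(\<Prod>p\<in>Q. 1 + 1 / real p) * real L
      = real (part_gcd P) * ((\<Prod>p\<in>Q. 1 + 1 / real p) * (\<Prod>p\<in>Q. real p))"
      by simp
    also have "(\<Prod>p\<in>Q. 1 + 1 / real p) * (\<Prod>p\<in>Q. real p) = (\<Prod>p\<in>Q. real p + 1)"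
      unfolding prod.distrib [symmetric] using Q(2) prime_gt_0_nat
      by (intro prod.cong) (auto simp: field_simps)
    finally show ?thesis by (simp add: divide_divide_eq_left)
  qed
  ultimately show ?thesis
    unfolding Q_def by (simp only:)
qed

end

theorem theorem3:
  fixes k :: nat
  assumes "k \<ge> 1"
  shows "has_mean_value (\<lambda>n. cyc_coeff n k)
    (complex_of_real (3 / pi\<^sup>2 *
      (\<Sum>P\<in>partitions k. part_eps P /
        (real (part_gcd P) *
          (\<Prod>p | prime p \<and> p dvd part_lcm P div part_gcd P. real p + 1)))))"
proof -
  let ?f = "\<lambda>P n. if part_lcm P dvd n then
    \<Prod>d\<in>set_mset P. (-1) ^ count P d * (real_of_int (moebius_mu (n div d)) gchoose count P d) else 0"
  have "nat_mean (\<lambda>n. \<Sum>P\<in>partitions k. ?f P n)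
    (\<Sum>P\<in>partitions k. 3 / pi\<^sup>2 * (part_eps P / (real (part_gcd P) *
      (\<Prod>p | prime p \<and> p dvd part_lcm P div part_gcd P. real p + 1))))"
    using assms by (intro nat_mean_sum nat_mean_partition_term) auto
  then show ?thesis
    unfolding sum_distrib_left [symmetric]
  proof (rule has_mean_value_of_nat_mean)
    fix n :: nat assume "n > 1"
    then show "cyc_coeff n k = of_real (\<Sum>P\<in>partitions k. ?f P n)"
      by (simp add: cyc_coeff_eq_sum_partitions of_real_gchoose if_distrib cong: if_cong)
  qed
qed

end
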